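(* Let $p\ge 2$, $1\le k<p$, $q=p-k$, $0<c_1\le c_2$, $\alpha>0$, $\beta>0$, let $S\in\mathbb{R}^{p\times p}$ be a sample covariance matrix (symmetric positive semidefinite) and $K=S+\alpha(2I-\mathbf{1}\mathbf{1}^T)$. Consider the problem $$\underset{\mathbf{w},\boldsymbol{\lambda},U}{\text{minimize}}\quad F(\mathbf{w},\boldsymbol{\lambda},U)=-\sum_{i=1}^{q}\log\lambda_i+\operatorname{tr}(K\,\mathcal{L}\mathbf{w})+\frac{\beta}{2}\left\|\mathcal{L}\mathbf{w}-U\,\mathrm{Diag}(\boldsymbol{\lambda})\,U^T\right\|_F^2$$ $$\text{subject to}\quad \mathbf{w}\ge 0,\quad c_1\le\lambda_1\le\cdots\le\lambda_q\le c_2,\quad U^TU=I_q,$$ over $\mathbf{w}\in\mathbb{R}^{p(p-1)/2}$, $\boldsymbol{\lambda}\in\mathbb{R}^q$, $U\in\mathbb{R}^{p\times q}$, where $\mathcal{L}$ is the graph Laplacian operator defined in the context. Let $(\mathbf{w}^t,U^t,\boldsymbol{\lambda}^t)_{t\ge0}$ be the sequence generated by the SGL algorithm (defined in the context), started from a feasible point. Then $(\mathbf{w}^t,U^t,\boldsymbol{\lambda}^t)$ converges to the set of KKT points of this problem, that is, its distance to the set of KKT points tends to $0$ as $t\to\infty$.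
   Context: Graph Laplacian operator. $\mathcal{L}:\mathbb{R}^{p(p-1)/2}\to\mathbb{R}^{p\times p}$ is the linear operator with $[\mathcal{L}\mathbf{w}]_{ij}=-w_{i+d_j}$ for $i>j$, where $d_j=-j+\frac{j-1}{2}(2p-j)$; $[\mathcal{L}\mathbf{w}]_{ij}=[\mathcal{L}\mathbf{w}]_{ji}$ for $i<j$; and $[\mathcal{L}\mathbf{w}]_{ii}=-\sum_{j\ne i}[\mathcal{L}\mathbf{w}]_{ij}$. For $\mathbf{w}\ge0$ (entrywise), $\mathcal{L}\mathbf{w}$ is the Laplacian matrix of the weighted graph with edge weights $\mathbf{w}$. $\mathcal{L}^*$ denotes its adjoint, $\langle\mathcal{L}\mathbf{w},Y\rangle=\langle\mathbf{w},\mathcal{L}^*Y\rangle$ for the standard (trace and dot) inner products. $\mathbf 1$ is the all-ones vector in $\mathbb{R}^p$, $\mathrm{Diag}(\boldsymbol\lambda)$ is the diagonal matrix with diagonal $\boldsymbol\lambda$, and $(a)^+=\max(a,0)$ entrywise. The problem is the formulation for learning a $k$-component graph: the first $k$ Laplacian eigenvalues are fixed to zero and only the $q=p-k$ nonzero ones (relabelled $\lambda_1,\dots,\lambda_q$) and the corresponding $q$ columns of $U$ are kept as variables. On the feasible set, $-\sum_i\log\lambda_i$ equals $-\log\mathrm{gdet}(U\mathrm{Diag}(\boldsymbol\lambda)U^T)$, where $\mathrm{gdet}$ is the product of the nonzero eigenvalues. SGL algorithm. At iteration $t$, given $(\mathbf{w}^t,U^t,\boldsymbol\lambda^t)$, the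 blocks are updated sequentially, always using the most recent values of the other blocks: 1. $\mathbf{w}^{t+1}=\left(\mathbf{w}^t-\frac{1}{2p}\nabla f(\mathbf{w}^t)\right)^+$, where $\nabla f(\mathbf{w}^t)=\mathcal{L}^*(\mathcal{L}\mathbf{w}^t)-\mathbf{c}$ and $\mathbf{c}=\mathcal{L}^*\left(U^t\mathrm{Diag}(\boldsymbol\lambda^t)(U^t)^T-\beta^{-1}K\right)$. 2. $U^{t+1}\in\mathbb{R}^{p\times q}$ has as its columns orthonormal eigenvectors of $\mathcal{L}\mathbf{w}^{t+1}$ for its $(k+1)$-th through $p$-th eigenvalues, the eigenvalues being listed in increasing order. 3. $\boldsymbol\lambda^{t+1}$ is the (unique) minimizer of $-\sum_{i=1}^q\log\lambda_i+\frac{\beta}{2}\|\boldsymbol\lambda-\mathbf{d}\|_2^2$ over $c_1\le\lambda_1\le\cdots\le\lambda_q\le c_2$, where $d_i$ is the $i$-th diagonal entry of $(U^{t+1})^T(\mathcal{L}\mathbf{w}^{t+1})U^{t+1}$. No stopping criterion is applied, so that the sequence is infinite. KKT points. A feasible point $(\mathbf{w},\boldsymbol\lambda,U)$ is a KKT point if there exist multipliers $\boldsymbol\mu\in\mathbb{R}^{p(p-1)/2}$ with $\boldsymbol\mu\ge0$, $\nu_0,\dots,\nu_q\ge0$, and a symmetric $M\in\mathbb{R}^{q\times q}$ such that the gradients with respect to $\mathbf{w}$, $\boldsymbol\lambda$ and $U$ of the Lagrangian $$F(\mathbf{w},\boldsymbol\lambda,U)-\boldsymbol\mu^T\mathbf{w}+\nu_0(c_1-\lambda_1)+\sum_{i=1}^{q-1}\nu_i(\lambda_i-\lambda_{i+1})+\nu_q(\lambda_q-c_2)+\operatorname{tr}\left(M(U^TU-I_q)\right)$$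 all vanish at the point, and complementary slackness holds: $\boldsymbol\mu^T\mathbf{w}=0$, $\nu_0(c_1-\lambda_1)=0$, $\nu_i(\lambda_i-\lambda_{i+1})=0$ for $1\le i\le q-1$, $\nu_q(\lambda_q-c_2)=0$. *)

theory Defs
  imports "HOL-Analysis.Analysis" "HOL-Computational_Algebra.Polynomial"
begin

text \<open>The type syntax \<open>real^'n\<close> pins an unannotated \<open>'n\<close> to sort \<open>finite\<close>; these synonyms
  leave the sort open. An \<open>('m, 'n) rmat\<close> has rows indexed by \<open>'m\<close> and columns by \<open>'n\<close>.\<close>

type_synonym 'n rvec = "(real, 'n) vec"
type_synonym ('m, 'n) rmat = "((real, 'n) vec, 'm) vec"

text \<open>Vectors and matrices are indexed by finite linearly ordered types: \<open>'p\<close> for the vertices,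
  \<open>'q\<close> for the retained eigenvalues and \<open>'e\<close> for the edge weights. Since several formulas do
  arithmetic on indices, \<open>pos\<close> and \<open>ix\<close> translate between such a type and the numbers 1, 2, ....\<close>

definition pos :: "'a::{finite,linorder} \<Rightarrow> nat" where
  "pos a = card {..a}"

definition ix :: "nat \<Rightarrow> 'a::{finite,linorder}" where
  "ix n = (THE a. pos a = n)"

text \<open>The product \<open>(j - 1) * (2 * p - j)\<close> is always even, so the integer division is exact.\<close>

definition lap_shift :: "nat \<Rightarrow> nat \<Rightarrow> int" where
  "lap_shift p j = - int j + (int j - 1) * (2 * int p - int j) div 2"

definition lap_off :: "'e::{finite,linorder} rvec \<Rightarrow> 'p::{finite,linorder} \<Rightarrow> 'p \<Rightarrow> real" where
  "lap_off w i j =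
     (if j < i then - w $ ix (nat (int (pos i) + lap_shift CARD('p) (pos j)))
      else - w $ ix (nat (int (pos j) + lap_shift CARD('p) (pos i))))"

text \<open>The graph Laplacian operator; meaningful when \<open>2 * CARD('e) = CARD('p) * (CARD('p) - 1)\<close>.\<close>

definition Lap :: "'e::{finite,linorder} rvec \<Rightarrow> ('p::{finite,linorder}, 'p) rmat" where
  "Lap w = (\<chi> i j. if i = j then - (\<Sum>m \<in> UNIV - {i}. lap_off w i m) else lap_off w i j)"

definition Diag :: "'n::finite rvec \<Rightarrow> ('n, 'n) rmat" where
  "Diag l = (\<chi> i j. if i = j then l $ i else 0)"

definition ones_mat :: "('n::finite, 'n) rmat" where
  "ones_mat = (\<chi> i j. 1)"

definition charpoly :: "('n::finite, 'n) rmat \<Rightarrow> real poly" where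
  "charpoly A = det (\<chi> i j. (if i = j then [:0, 1:] else 0) - [:A $ i $ j:])"

text \<open>The \<open>i\<close>-th smallest eigenvalue, counted from 1 and with multiplicity. Only real roots are
  counted, so for \<open>1 \<le> i \<le> CARD('n)\<close> this is meaningful for matrices with real spectrum,
  in particular for symmetric ones.\<close>

definition eigval :: "('n::finite, 'n) rmat \<Rightarrow> nat \<Rightarrow> real" where
  "eigval A i = sorted_list_of_multiset (proots (charpoly A)) ! (i - 1)"

definition chain_set :: "real \<Rightarrow> real \<Rightarrow> 'q::{finite,linorder} rvec set" where
  "chain_set c1 c2 =
     {l. c1 \<le> l $ ix 1 \<and> (\<forall>i. 1 \<le> i \<and> i < CARD('q) \<longrightarrow> l $ ix i \<le> l $ ix (i + 1)) \<and>
         l $ ix CARD('q) \<le> c2}"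

text \<open>On matrices, \<open>norm\<close> is the Frobenius norm and \<open>inner\<close> the trace inner product.\<close>

definition objective ::
  "('p::{finite,linorder}, 'p) rmat \<Rightarrow> real \<Rightarrow> 'e::{finite,linorder} rvec \<Rightarrow> 'q::{finite,linorder} rvec
     \<Rightarrow> ('p, 'q) rmat \<Rightarrow> real" where
  "objective K \<beta> w l U =
     - (\<Sum>i\<in>UNIV. ln (l $ i)) + trace (K ** Lap w)
     + \<beta> / 2 * (norm (Lap w - U ** Diag l ** transpose U))\<^sup>2"

definition feasible ::
  "real \<Rightarrow> real \<Rightarrow> 'e::{finite,linorder} rvec \<Rightarrow> 'q::{finite,linorder} rvec
     \<Rightarrow> ('p::{finite,linorder}, 'q) rmat \<Rightarrow> bool" where
  "feasible c1 c2 w l U \<longleftrightarrow>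
     (\<forall>e. 0 \<le> w $ e) \<and> l \<in> chain_set c1 c2 \<and> transpose U ** U = mat 1"

definition lagrangian ::
  "('p::{finite,linorder}, 'p) rmat \<Rightarrow> real \<Rightarrow> real \<Rightarrow> real \<Rightarrow> 'e::{finite,linorder} rvec \<Rightarrow> (nat \<Rightarrow> real) \<Rightarrow> ('q::{finite,linorder}, 'q) rmat
     \<Rightarrow> 'e rvec \<Rightarrow> 'q rvec
     \<Rightarrow> ('p, 'q) rmat \<Rightarrow> real" where
  "lagrangian K \<beta> c1 c2 \<mu> \<nu> M w l U =
     objective K \<beta> w l U - \<mu> \<bullet> w
     + \<nu> 0 * (c1 - l $ ix 1)
     + (\<Sum>i = 1..<CARD('q). \<nu> i * (l $ ix i - l $ ix (i + 1)))
     + \<nu> CARD('q) * (l $ ix CARD('q) - c2)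
     + trace (M ** (transpose U ** U - mat 1))"

definition kkt_points ::
  "('p::{finite,linorder}, 'p) rmat \<Rightarrow> real \<Rightarrow> real \<Rightarrow> real
     \<Rightarrow> ('e::{finite,linorder} rvec \<times> 'q::{finite,linorder} rvec \<times> ('p, 'q) rmat) set" where
  "kkt_points K \<beta> c1 c2 =
     {(w, l, U). feasible c1 c2 w l U \<and>
        (\<exists>\<mu> \<nu> M.
           (\<forall>e. 0 \<le> \<mu> $ e) \<and> (\<forall>i \<le> CARD('q). 0 \<le> \<nu> i) \<and> transpose M = M \<and>
           GDERIV (\<lambda>w'. lagrangian K \<beta> c1 c2 \<mu> \<nu> M w' l U) w :> 0 \<and>
           GDERIV (\<lambda>l'. lagrangian K \<beta> c1 c2 \<mu> \<nu> M w l' U) l :> 0 \<and>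
           GDERIV (\<lambda>U'. lagrangian K \<beta> c1 c2 \<mu> \<nu> M w l U') U :> 0 \<and>
           \<mu> \<bullet> w = 0 \<and>
           \<nu> 0 * (c1 - l $ ix 1) = 0 \<and>
           (\<forall>i. 1 \<le> i \<and> i < CARD('q) \<longrightarrow> \<nu> i * (l $ ix i - l $ ix (i + 1)) = 0) \<and>
           \<nu> CARD('q) * (l $ ix CARD('q) - c2) = 0)}"

definition grad_w ::
  "('p::{finite,linorder}, 'p) rmat \<Rightarrow> real \<Rightarrow> 'e::{finite,linorder} rvec \<Rightarrow> 'q::{finite,linorder} rvec
     \<Rightarrow> ('p, 'q) rmat \<Rightarrow> 'e rvec" where
  "grad_w K \<beta> w l U =
     adjoint Lap (Lap w :: ('p, 'p) rmat)
     - adjoint Lap (U ** Diag l ** transpose U - (1 / \<beta>) *\<^sub>R K)"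

definition w_update ::
  "('p::{finite,linorder}, 'p) rmat \<Rightarrow> real \<Rightarrow> 'e::{finite,linorder} rvec \<Rightarrow> 'q::{finite,linorder} rvec
     \<Rightarrow> ('p, 'q) rmat \<Rightarrow> 'e rvec" where
  "w_update K \<beta> w l U =
     (\<chi> e. max ((w - (1 / (2 * real CARD('p))) *\<^sub>R grad_w K \<beta> w l U) $ e) 0)"

text \<open>Eigenvectors, and hence the \<open>U\<close>-update, are not unique: any choice is allowed.\<close>

definition is_U_update ::
  "nat \<Rightarrow> ('p::{finite,linorder}, 'p) rmat \<Rightarrow> ('p, 'q::{finite,linorder}) rmat \<Rightarrow> bool" where
  "is_U_update k A U \<longleftrightarrow>
     transpose U ** U = mat 1 \<and>
     (\<forall>i. 1 \<le> i \<and> i \<le> CARD('q) \<longrightarrow>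
        A *v column (ix i) U = eigval A (k + i) *\<^sub>R column (ix i) U)"

definition is_l_update ::
  "real \<Rightarrow> real \<Rightarrow> real \<Rightarrow> ('p::{finite,linorder}, 'p) rmat \<Rightarrow> ('p, 'q::{finite,linorder}) rmat
     \<Rightarrow> 'q rvec \<Rightarrow> bool" where
  "is_l_update \<beta> c1 c2 A U l \<longleftrightarrow>
     is_arg_min
       (\<lambda>x. - (\<Sum>i\<in>UNIV. ln (x $ i))
            + \<beta> / 2 * (norm (x - (\<chi> i. (transpose U ** A ** U) $ i $ i)))\<^sup>2)
       (\<lambda>x. x \<in> chain_set c1 c2) l"

definition sgl_sequence ::
  "nat \<Rightarrow> ('p::{finite,linorder}, 'p) rmat \<Rightarrow> real \<Rightarrow> real \<Rightarrow> real
     \<Rightarrow> (nat \<Rightarrow> 'e::{finite,linorder} rvec) \<Rightarrow> (nat \<Rightarrow> 'q::{finite,linorder} rvec)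
     \<Rightarrow> (nat \<Rightarrow> ('p, 'q) rmat) \<Rightarrow> bool" where
  "sgl_sequence k K \<beta> c1 c2 w l U \<longleftrightarrow>
     (\<forall>t. w (Suc t) = w_update K \<beta> (w t) (l t) (U t) \<and>
          is_U_update k (Lap (w (Suc t))) (U (Suc t)) \<and>
          is_l_update \<beta> c1 c2 (Lap (w (Suc t))) (U (Suc t)) (l (Suc t)))"

end

theory Submission
  imports Defs
begin

text \<open>The projected gradient step has step length \<open>1 / (2 * p)\<close>, and \<open>\<parallel>Lap w\<parallel>\<^sup>2 \<le> 2 * p * \<parallel>w\<parallel>\<^sup>2\<close>, so it lowers
  the objective by at least \<open>\<beta> * p\<close> times its squared length. The \<open>U\<close>-step is optimal by a weighted
  Ky Fan inequality and the \<open>l\<close>-step is optimal by definition, so neither raises the objective.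
  The term \<open>trace (K ** Lap w)\<close> dominates \<open>4 * \<alpha>\<close> times the sum of the weights, so the objective is
  bounded below and coercive: the iterates stay bounded and consecutive weights approach
  each other. In the limit along a subsequence the weights are therefore a fixed point of the
  gradient step, the columns of \<open>U\<close> are eigenvectors of \<open>Lap w\<close>, and \<open>l\<close> solves its subproblem;
  these three properties yield the KKT multipliers. No convergence of the eigenvectors themselves
  is needed.\<close>

section \<open>Indices and the chain constraint\<close>

text \<open>What helps is the order of the updates. At every iterate after the initial one,
  \<open>U\<close> and \<open>l\<close> were computed from the \<open>w\<close> of that same
  iterate, so their optimality conditions hold there exactly and only have to survive limits. Only
  the condition on \<open>w\<close> links an iterate to the next one, and the \<open>w\<close>-step
  is the one with a quantified decrease. Limits are taken of the iterates \<open>Suc t\<close>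
  because the starting triple is merely feasible. A second point is that the eigenvalues of the
  \<open>U\<close>-step are given as sorted roots of a polynomial. They are matched with an
  orthonormal eigenbasis through an identity of multisets, which copes with repeated eigenvalues;
  for limits they are replaced by the diagonal of \<open>transpose U ** A ** U\<close>, which is
  continuous in \<open>A\<close> and \<open>U\<close>.\<close>

lemma pos_less: "a < b \<Longrightarrow> pos a < pos (b::'a::{finite,linorder})"
  unfolding pos_def by (rule psubset_card_mono) auto

lemma pos_less_iff: "pos a < pos b \<longleftrightarrow> a < (b::'a::{finite,linorder})"
  by (metis pos_less less_asym linorder_neqE)

lemma inj_pos: "inj (pos :: 'a::{finite,linorder} \<Rightarrow> nat)"
  by (metis injI linorder_neqE pos_less less_irrefl)

lemma bij_pos: "bij_betw (pos :: 'a::{finite,linorder} \<Rightarrow> nat) UNIV {1..CARD('a)}"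
proof -
  have "pos a \<in> {1..CARD('a)}" for a :: 'a
    unfolding pos_def by (auto simp: Suc_le_eq card_gt_0_iff intro!: card_mono)
  then have "range (pos :: 'a \<Rightarrow> nat) = {1..CARD('a)}"
    by (intro card_subset_eq) (auto simp: card_image inj_pos)
  then show ?thesis
    using inj_pos by (simp add: bij_betw_def)
qed

lemma pos_ge_1: "1 \<le> pos (a::'a::{finite,linorder})"
  and pos_le_card: "pos a \<le> CARD('a)"
  using bij_pos[where 'a='a] by (auto simp: bij_betw_def)

lemma ix_pos [simp]: "ix (pos a) = (a::'a::{finite,linorder})"
  unfolding ix_def by (rule the_equality) (auto dest: injD[OF inj_pos])

lemma pos_ix: "1 \<le> n \<Longrightarrow> n \<le> CARD('a) \<Longrightarrow> pos (ix n :: 'a::{finite,linorder}) = n"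
  by (metis (no_types, lifting) atLeastAtMost_iff bij_betw_def bij_pos imageE ix_pos)

lemma bij_ix: "bij_betw (ix :: nat \<Rightarrow> 'a::{finite,linorder}) {1..CARD('a)} UNIV"
  by (rule bij_betwI[where g = pos]) (use pos_ge_1 pos_le_card in \<open>auto simp: pos_ix\<close>)

lemma sum_ix: "(\<Sum>n = 1..CARD('a). f (ix n)) = (\<Sum>a\<in>UNIV. f (a::'a::{finite,linorder}))"
  by (rule sum.reindex_bij_betw[OF bij_ix])

text \<open>The definition compares neighbours only. Chaining these comparisons gives monotonicity
  on the index type, the form needed for entrywise bounds and for the weights in the eigenvalue
  inequality.\<close>

lemma chain_set_iff:
  "l \<in> chain_set c1 c2 \<longleftrightarrow>
     c1 \<le> l $ ix 1 \<and> mono (($) l) \<and> l $ ix CARD('q) \<le> c2" for l :: "'q::{finite,linorder} rvec"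
proof -
  have "(\<forall>i. 1 \<le> i \<and> i < CARD('q) \<longrightarrow> l $ ix i \<le> l $ ix (i + 1)) \<longleftrightarrow> mono (($) l)" (is "?L = ?R")
  proof
    assume L: ?L
    have *: "1 \<le> m \<Longrightarrow> n \<le> CARD('q) \<Longrightarrow> l $ ix m \<le> l $ ix n" if "m \<le> n" for m n
      using that
    proof (induction n rule: dec_induct)
      case (step n)
      then have "l $ ix n \<le> l $ ix (n + 1)" using L by auto
      then show ?case using step by auto
    qed auto
    show ?R
    proof
      fix a b :: 'q assume "a \<le> b"
      then have "pos a \<le> pos b" by (auto simp: order_le_less dest: pos_less)
      then show "l $ a \<le> l $ b" using *[of "pos a" "pos b"] pos_ge_1[of a] pos_le_card[of b] by simp
    qed
  next
    assume R: ?R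
    show ?L
    proof (intro allI impI)
      fix i assume i: "1 \<le> i \<and> i < CARD('q)"
      then have "pos (ix i :: 'q) < pos (ix (i+1) :: 'q)" by (simp add: pos_ix)
      then have "(ix i :: 'q) \<le> ix (i+1)" by (simp add: pos_less_iff)
      then show "l $ ix i \<le> l $ ix (i+1)" using R by (auto dest: monoD)
    qed
  qed
  then show ?thesis by (auto simp: chain_set_def)
qed

lemma ix_1_le: "(ix 1 :: 'a::{finite,linorder}) \<le> a"
proof -
  have "\<not> pos a < pos (ix 1 :: 'a)"
    using pos_ge_1[of a] pos_le_card[of a] by (simp add: pos_ix del: One_nat_def)
  then show ?thesis by (simp add: pos_less_iff)
qed

lemma le_ix_card: "(a :: 'a::{finite,linorder}) \<le> ix CARD('a)"
proof -
  have "\<not> pos (ix CARD('a) :: 'a) < pos a"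
    using pos_ge_1[of a] pos_le_card[of a] by (simp add: pos_ix del: One_nat_def)
  then show ?thesis by (simp add: pos_less_iff)
qed

lemma chain_set_bounds:
  "l \<in> chain_set c1 c2 \<Longrightarrow> c1 \<le> l $ a" "l \<in> chain_set c1 c2 \<Longrightarrow> l $ a \<le> c2"
  unfolding chain_set_iff by (meson ix_1_le le_ix_card monoD order_trans)+

section \<open>The Laplacian operator\<close>

text \<open>The index formula of the operator under a name, meaningful for \<open>j < i\<close>
  only. On the diagonal \<open>lap_off\<close> picks some meaningless weight, which is why row sums
  of it leave out \<open>i\<close> itself.\<close>

definition edge :: "'p::{finite,linorder} \<Rightarrow> 'p \<Rightarrow> 'e::{finite,linorder}" where
  "edge i j = ix (nat (int (pos i) + lap_shift CARD('p) (pos j)))"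

lemma lap_off_edge: "lap_off w i j = (if j < i then - w $ edge i j else - w $ edge j i)"
  by (simp add: lap_off_def edge_def)

text \<open>\<open>edge\<close> enumerates the pairs \<open>j < i\<close> column by column; \<open>tri p j\<close> counts the pairs in the columns
  before \<open>j\<close>.\<close>

definition tri :: "nat \<Rightarrow> nat \<Rightarrow> nat" where
  "tri p j = (\<Sum>m = 1..<j. p - m)"

lemma tri_Suc: "1 \<le> j \<Longrightarrow> tri p (Suc j) = tri p j + (p - j)"
  by (simp add: tri_def)

text \<open>Doubled and over the integers, so that no division enters the induction; it shows that
  the division in \<open>lap_shift\<close> is exact.\<close>

lemma two_tri: "1 \<le> j \<Longrightarrow> j \<le> p \<Longrightarrow> 2 * int (tri p j) = (int j - 1) * (2 * int p - int j)"
proof (induction j rule: dec_induct)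
  case base then show ?case by (simp add: tri_def)
next
  case (step n) then show ?case by (simp add: tri_Suc algebra_simps of_nat_diff)
qed

lemma lap_shift_tri: "1 \<le> j \<Longrightarrow> j \<le> p \<Longrightarrow> lap_shift p j = int (tri p j) - int j"
  unfolding lap_shift_def two_tri[symmetric] by simp

lemma tri_mono: "i \<le> j \<Longrightarrow> tri p i \<le> tri p j"
  unfolding tri_def by (rule sum_mono2) auto

lemma edge_tri: "edge i j = ix (tri CARD('p) (pos j) + (pos i - pos j))" if "j < i" for i j :: "'p::{finite,linorder}"
proof -
  have "int (pos i) + lap_shift CARD('p) (pos j) = int (tri CARD('p) (pos j) + (pos i - pos j))"
    using pos_less[OF that] pos_ge_1[of j] pos_le_card[of j] by (simp add: lap_shift_tri)
  then show ?thesis unfolding edge_def by (metis nat_int)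
qed

text \<open>Column \<open>j\<close> fills \<open>p - j\<close> positions, so it ends before any
  later column begins. Both the range and the injectivity of \<open>edge\<close> rest on
  this.\<close>

lemma tri_offset_le:
  assumes "1 \<le> j" "j < j'" "i \<le> p"
  shows "tri p j + (i - j) \<le> tri p j'"
  using tri_mono[of "Suc j" j' p] assms by (simp add: tri_Suc)

lemma card_less_pairs:
  "card {(i, j). j < (i::'p::{finite,linorder})} = CARD('p) * (CARD('p) - 1) div 2"
proof -
  let ?L = "{(i, j). j < (i::'p)}" and ?D = "range (\<lambda>i::'p. (i, i))"
  have "(UNIV :: ('p \<times> 'p) set) = (?L \<union> prod.swap ` ?L) \<union> ?D"
    by (auto simp: image_iff)
  then have "CARD('p \<times> 'p) = card ((?L \<union> prod.swap ` ?L) \<union> ?D)" by (rule arg_cong)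
  also have "\<dots> = card (?L \<union> prod.swap ` ?L) + card ?D"
    by (rule card_Un_disjoint) auto
  also have "card ?D = CARD('p)" by (rule card_image) (auto intro: injI)
  also have "card (?L \<union> prod.swap ` ?L) = card ?L + card (prod.swap ` ?L)"
    by (rule card_Un_disjoint) auto
  also have "card (prod.swap ` ?L) = card ?L" by (rule card_image) (auto intro: inj_onI)
  finally show ?thesis by (simp add: diff_mult_distrib2)
qed

lemma bij_edge:
  assumes "CARD('e::{finite,linorder}) = CARD('p::{finite,linorder}) * (CARD('p) - 1) div 2"
  shows "bij_betw (\<lambda>(i::'p, j). edge i j :: 'e) {(i, j). j < i} UNIV"
proof -
  let ?p = "CARD('p)" and ?n = "\<lambda>i j :: 'p. tri CARD('p) (pos j) + (pos i - pos j)"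
  \<comment> \<open>Column \<open>p\<close> contains no pair, so \<open>tri p p\<close> already
    counts all edges.\<close>
  have "2 * int (tri ?p ?p) = int ?p * (int ?p - 1)"
    by (subst two_tri) (auto simp: Suc_le_eq algebra_simps)
  then have "2 * int (tri ?p ?p) = int (?p * (?p - 1))"
    by (simp add: of_nat_diff Suc_le_eq)
  then have tri: "tri ?p ?p = CARD('e)" unfolding assms by presburger
  have pos: "pos (edge i j :: 'e) = ?n i j" if "j < i" for i j :: 'p
  proof -
    have "?n i j \<le> CARD('e)"
      using tri_offset_le[of "pos j" ?p "pos i" ?p] pos_less[OF that] pos_ge_1[of j] pos_le_card[of i] tri
      by linarith
    moreover have "1 \<le> ?n i j" using pos_less[OF that] by linarith
    ultimately show ?thesis by (simp add: edge_tri[OF that] pos_ix)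
  qed
  have "inj_on (\<lambda>(i::'p, j). edge i j :: 'e) {(i, j). j < i}"
  proof (rule inj_onI, clarify)
    fix i j i' j' :: 'p assume l: "j < i" "j' < i'" and e: "(edge i j :: 'e) = edge i' j'"
    have n: "?n i j = ?n i' j'" using pos l e by metis
    have "\<not> pos j < pos j'" "\<not> pos j' < pos j"
      using tri_offset_le[of "pos j" "pos j'" "pos i" ?p] tri_offset_le[of "pos j'" "pos j" "pos i'" ?p] n
        pos_less[OF l(1)] pos_less[OF l(2)] pos_ge_1[of j] pos_ge_1[of j'] pos_le_card[of i] pos_le_card[of i']
      by linarith+
    then have "pos j = pos j'" by simp
    with n pos_less[OF l(1)] pos_less[OF l(2)] have "pos i = pos i'" by simp
    with \<open>pos j = pos j'\<close> show "i = i' \<and> j = j'" by (metis ix_pos)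
  qed
  moreover from this have "(\<lambda>(i::'p, j). edge i j :: 'e) ` {(i, j). j < i} = UNIV"
    by (intro card_subset_eq) (auto simp: card_image card_less_pairs assms)
  ultimately show ?thesis by (simp add: bij_betw_def)
qed

text \<open>Every edge occurs in both orders, hence the factor 2. The free \<open>f\<close> lets one
  count serve the trace (\<open>uminus\<close>) and the Frobenius norm (squaring).\<close>

lemma sum_lap_off:
  fixes w :: "'e::{finite,linorder} rvec" and f :: "real \<Rightarrow> real"
  assumes "CARD('e) = CARD('p::{finite,linorder}) * (CARD('p) - 1) div 2"
  shows "(\<Sum>i\<in>UNIV. \<Sum>j\<in>UNIV - {i}. f (lap_off w (i::'p) j)) = 2 * (\<Sum>e\<in>UNIV. f (- w $ e))"
proof -
  let ?L = "{(i, j). j < (i::'p)}" and ?g = "\<lambda>(i::'p, j). f (lap_off w i j)"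
  have "(\<Sum>i\<in>UNIV. \<Sum>j\<in>UNIV - {i}. f (lap_off w (i::'p) j)) = sum ?g (SIGMA i:UNIV. UNIV - {i})"
    by (rule sum.Sigma) auto
  also have "(SIGMA i:UNIV. UNIV - {i::'p}) = ?L \<union> prod.swap ` ?L"
    by (auto simp: image_iff)
  also have "sum ?g (?L \<union> prod.swap ` ?L) = sum ?g ?L + sum ?g (prod.swap ` ?L)"
    by (rule sum.union_disjoint) auto
  also have "sum ?g (prod.swap ` ?L) = sum ?g ?L"
    by (subst sum.reindex) (auto simp: lap_off_edge intro!: sum.cong)
  also have "sum ?g ?L = (\<Sum>x\<in>?L. f (- w $ (case x of (i, j) \<Rightarrow> edge i j)))"
    by (rule sum.cong) (auto simp: lap_off_edge)
  also have "\<dots> = (\<Sum>e\<in>UNIV. f (- w $ e))"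
    by (rule sum.reindex_bij_betw[OF bij_edge[OF assms]])
  finally show ?thesis by simp
qed

lemma lap_off_commute: "i \<noteq> j \<Longrightarrow> lap_off w i j = lap_off w j i"
  by (auto simp: lap_off_edge)

lemma transpose_Lap: "transpose (Lap w) = Lap w"
  by (auto simp: transpose_def Lap_def vec_eq_iff lap_off_commute)

lemma lap_off_add: "lap_off (x + y) i j = lap_off x i j + lap_off y i j"
  and lap_off_scaleR: "lap_off (c *\<^sub>R x) i j = c * lap_off x i j"
  by (simp_all add: lap_off_edge)

lemma linear_Lap: "linear Lap"
  by (rule linearI)
    (auto simp: Lap_def vec_eq_iff lap_off_add lap_off_scaleR sum.distrib sum_distrib_left)

lemma Lap_row_sum: "(\<Sum>j\<in>UNIV. Lap w $ i $ j) = 0"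
proof -
  have "(\<Sum>j\<in>UNIV. Lap w $ i $ j) = Lap w $ i $ i + (\<Sum>j\<in>UNIV - {i}. Lap w $ i $ j)"
    by (rule sum.remove) auto
  then show ?thesis by (auto simp: Lap_def)
qed

lemma trace_Lap:
  assumes "CARD('e) = CARD('p) * (CARD('p) - 1) div 2"
  shows "trace (Lap w :: ('p::{finite,linorder}, 'p) rmat) = 2 * (\<Sum>e\<in>UNIV. (w::'e::{finite,linorder} rvec) $ e)"
  using sum_lap_off[OF assms, of uminus w] by (simp add: trace_def Lap_def sum_negf)

section \<open>Operator norm and coercivity bounds\<close>

lemma norm_sq_mat: "(norm A)\<^sup>2 = (\<Sum>i\<in>UNIV. \<Sum>j\<in>UNIV. (A $ i $ j)\<^sup>2)" for A :: "real^'n^'m"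
  unfolding power2_norm_eq_inner by (simp add: inner_vec_def power2_eq_square)

text \<open>In row \<open>i\<close> the diagonal entry is a sum of \<open>p - 1\<close> off-diagonal
  ones; Cauchy-Schwarz bounds its square by \<open>p - 1\<close> times their sum of squares, which
  makes \<open>p\<close> times in total. Each edge lies in two rows, whence 2p, the source of the
  step length.\<close>

lemma norm_Lap_le:
  fixes w :: "'e::{finite,linorder} rvec"
  assumes "CARD('e) = CARD('p) * (CARD('p) - 1) div 2"
  shows "(norm (Lap w :: ('p::{finite,linorder}, 'p) rmat))\<^sup>2 \<le> 2 * real CARD('p) * (norm w)\<^sup>2"
proof -
  let ?s = "\<lambda>i::'p. \<Sum>j\<in>UNIV - {i}. (lap_off w i j)\<^sup>2"
  have row: "(\<Sum>j\<in>UNIV. ((Lap w :: ('p, 'p) rmat) $ i $ j)\<^sup>2) \<le> real CARD('p) * ?s i" for i :: 'p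
  proof -
    have "(\<Sum>j\<in>UNIV. ((Lap w :: ('p, 'p) rmat) $ i $ j)\<^sup>2) = (\<Sum>m\<in>UNIV - {i}. lap_off w i m)\<^sup>2 + ?s i"
      by (subst sum.remove[of _ i]) (auto simp: Lap_def intro!: sum.cong)
    also have "(\<Sum>m\<in>UNIV - {i}. lap_off w i m)\<^sup>2 \<le> (\<Sum>m\<in>UNIV - {i}. (lap_off w i m)\<^sup>2) * card (UNIV - {i})"
      using Cauchy_Schwarz_ineq_sum[of "lap_off w i" "\<lambda>_. 1" "UNIV - {i}"] by simp
    finally show ?thesis by (simp add: card_Diff_singleton of_nat_diff Suc_le_eq algebra_simps)
  qed
  have "(norm (Lap w :: ('p, 'p) rmat))\<^sup>2 \<le> (\<Sum>i\<in>UNIV. real CARD('p) * ?s i)"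
    unfolding norm_sq_mat by (rule sum_mono) (rule row)
  also have "\<dots> = real CARD('p) * (2 * (\<Sum>e\<in>UNIV. (- w $ e)\<^sup>2))"
    unfolding sum_distrib_left[symmetric] sum_lap_off[OF assms, of "\<lambda>x. x\<^sup>2" w] ..
  also have "\<dots> = 2 * real CARD('p) * (norm w)\<^sup>2"
    unfolding power2_norm_eq_inner by (simp add: inner_vec_def power2_eq_square)
  finally show ?thesis .
qed

lemma trace_mult_eq_inner: "trace (A ** B) = transpose A \<bullet> B" for A :: "real^'n^'m" and B :: "real^'m^'n"
  unfolding trace_def matrix_matrix_mult_def transpose_def inner_vec_def
  by simp (rule sum.swap)

text \<open>The Laplacian is the sum over the edges ij of the weight times the rank-one matrix of
  e_i - e_j, so the trace is a weighted sum of values of the quadratic form of \<open>S\<close> at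
  the vectors e_i - e_j.\<close>

lemma trace_psd_Lap_nonneg:
  fixes S :: "('p::{finite,linorder}, 'p) rmat"
  assumes S: "transpose S = S" "\<forall>x. 0 \<le> x \<bullet> (S *v x)" and w: "\<forall>e. 0 \<le> w $ e"
  shows "0 \<le> trace (S ** Lap w)"
proof -
  let ?N = "\<lambda>i::'p. UNIV - {i}"
  have sym: "S $ i $ j = S $ j $ i" for i j
    using S(1) by (metis transpose_def vec_lambda_beta)
  have pair: "0 \<le> S $ i $ i + S $ j $ j - 2 * S $ i $ j" for i j
  proof -
    have "(axis i 1 - axis j 1) \<bullet> (S *v (axis i 1 - axis j 1)) = S $ i $ i + S $ j $ j - 2 * S $ i $ j"
      by (simp add: matrix_vector_mult_diff_distrib inner_diff_left inner_axis' matrix_vector_mult_basis column_def sym)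
    then show ?thesis using S(2) by metis
  qed
  have off: "lap_off w i j \<le> 0" for i j using w by (simp add: lap_off_def)
  have "trace (S ** Lap w) = (\<Sum>i\<in>UNIV. \<Sum>j\<in>UNIV. S $ i $ j * Lap w $ i $ j)"
    by (simp add: trace_mult_eq_inner S(1) inner_vec_def)
  also have "\<dots> = (\<Sum>i\<in>UNIV. \<Sum>j\<in>?N i. (S $ i $ j - S $ i $ i) * lap_off w i j)"
  proof (rule sum.cong[OF refl])
    fix i
    have "(\<Sum>j\<in>UNIV. S $ i $ j * Lap w $ i $ j) = S $ i $ i * - (\<Sum>j\<in>?N i. lap_off w i j) + (\<Sum>j\<in>?N i. S $ i $ j * lap_off w i j)"
      by (subst sum.remove[of _ i]) (auto simp: Lap_def intro!: sum.cong)
    then show "(\<Sum>j\<in>UNIV. S $ i $ j * Lap w $ i $ j) = (\<Sum>j\<in>?N i. (S $ i $ j - S $ i $ i) * lap_off w i j)"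
      by (simp add: algebra_simps sum_subtractf sum_distrib_left)
  qed
  finally have 1: "trace (S ** Lap w) = (\<Sum>i\<in>UNIV. \<Sum>j\<in>?N i. (S $ i $ j - S $ i $ i) * lap_off w i j)" .
  also have "\<dots> = (\<Sum>(i,j)\<in>(SIGMA i:UNIV. ?N i). (S $ i $ j - S $ i $ i) * lap_off w i j)"
    by (rule sum.Sigma) auto
  \<comment> \<open>Exchanging \<open>i\<close> and \<open>j\<close> turns one diagonal entry of
    \<open>S\<close> into the other; adding both versions produces the quadratic form at e_i -
    e_j.\<close>
  also have "\<dots> = (\<Sum>(i,j)\<in>(SIGMA i:UNIV. ?N i). (S $ i $ j - S $ j $ j) * lap_off w i j)"
    by (rule sum.reindex_bij_witness[of _ prod.swap prod.swap]) (auto simp: sym, metis lap_off_commute)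
  also have "\<dots> = (\<Sum>i\<in>UNIV. \<Sum>j\<in>?N i. (S $ i $ j - S $ j $ j) * lap_off w i j)"
    by (rule sum.Sigma[symmetric]) auto
  finally have 2: "trace (S ** Lap w) = (\<Sum>i\<in>UNIV. \<Sum>j\<in>?N i. (S $ i $ j - S $ j $ j) * lap_off w i j)" .
  have "2 * trace (S ** Lap w) =
      (\<Sum>i\<in>UNIV. \<Sum>j\<in>?N i. (S $ i $ i + S $ j $ j - 2 * S $ i $ j) * - lap_off w i j)"
    unfolding mult_2 by (subst 1, subst 2, unfold sum.distrib[symmetric]) (intro sum.cong refl, algebra)
  also have "0 \<le> \<dots>"
    by (intro sum_nonneg mult_nonneg_nonneg pair) (use off in auto)
  finally show ?thesis by simp
qed

text \<open>The all-ones matrix contributes nothing because the rows of \<open>Lap w\<close> sum to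
  zero; twice the identity contributes twice the trace, and the trace is twice the total weight.
  Hence the 4.\<close>

lemma trace_K_Lap_ge:
  fixes S :: "('p::{finite,linorder}, 'p) rmat" and w :: "'e::{finite,linorder} rvec"
  assumes e: "CARD('e) = CARD('p) * (CARD('p) - 1) div 2"
    and S: "transpose S = S" "\<forall>x. 0 \<le> x \<bullet> (S *v x)" and w: "\<forall>e. 0 \<le> w $ e"
    and K: "K = S + \<alpha> *\<^sub>R (2 *\<^sub>R mat 1 - ones_mat)"
  shows "4 * \<alpha> * (\<Sum>e\<in>UNIV. w $ e) \<le> trace (K ** Lap w)"
proof -
  have "trace (mat 1 ** Lap w :: ('p, 'p) rmat) = 2 * (\<Sum>e\<in>UNIV. w $ e)" 
    using trace_Lap[OF e, of w] by simp
  moreover have "trace (ones_mat ** Lap w :: ('p, 'p) rmat) = 0"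
    by (simp add: trace_mult_eq_inner inner_vec_def transpose_def ones_mat_def Lap_row_sum)
  moreover have trans: "transpose K = transpose S + \<alpha> *\<^sub>R (2 *\<^sub>R transpose (mat 1) - transpose ones_mat)"
    by (simp add: K transpose_def vec_eq_iff)
  ultimately have "trace (K ** Lap w) = trace (S ** Lap w) + 4 * \<alpha> * (\<Sum>e\<in>UNIV. w $ e)"
    unfolding trace_mult_eq_inner trans by (simp add: inner_add_left inner_diff_left)
  then show ?thesis using trace_psd_Lap_nonneg[OF S w] by simp
qed

section \<open>Eigenbases of symmetric matrices\<close>

lemma inner_symmetric_matrix: "transpose A = A \<Longrightarrow> x \<bullet> (A *v y) = (A *v x) \<bullet> y" for A :: "real^'n^'n"
  by (metis dot_lmul_matrix vector_transpose_matrix)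

text \<open>A quadratic in \<open>s\<close> that never exceeds its value at 0 has no slope there.
  The test value \<open>s\<close> is chosen small enough for the linear term to beat the quadratic
  one.\<close>

lemma linear_coefficient_zero:
  fixes a c :: real
  assumes "\<And>s. 2 * s * a + s\<^sup>2 * c \<le> 0"
  shows "a = 0"
proof (rule ccontr)
  assume "a \<noteq> 0"
  define s where "s = a / (\<bar>c\<bar> + 1)"
  have "s * (\<bar>c\<bar> + 1) = a" by (simp add: s_def)
  then have "2 * s * a + s\<^sup>2 * c = s\<^sup>2 * (2 * \<bar>c\<bar> + 2 + c)" by (auto simp: power2_eq_square algebra_simps)
  moreover have "s \<noteq> 0" using \<open>a \<noteq> 0\<close> by (simp add: s_def add_nonneg_eq_0_iff)
  ultimately show False using assms[of s] by (smt (verit) mult_pos_pos zero_less_power2)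
qed

text \<open>A maximiser \<open>x\<close> of the Rayleigh quotient on the unit sphere of
  \<open>S\<close> works: its residual \<open>y\<close> lies in \<open>S\<close> and is orthogonal
  to \<open>x\<close>, and moving \<open>x\<close> along \<open>y\<close> changes the quotient to
  first order by a multiple of \<open>y \<bullet> y\<close>, which must vanish.\<close>

lemma symmetric_invariant_subspace_eigenvector:
  fixes A :: "real^'n^'n"
  assumes A: "transpose A = A" and S: "subspace S" "S \<noteq> {0}" and inv: "\<And>x. x \<in> S \<Longrightarrow> A *v x \<in> S"
  shows "\<exists>x\<in>S. norm x = 1 \<and> A *v x = (x \<bullet> (A *v x)) *\<^sub>R x"
proof -
  obtain z where z: "z \<in> S" "z \<noteq> 0" using S subspace_0 by blast
  let ?C = "S \<inter> sphere 0 1"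
  have "compact ?C" using closed_subspace[OF S(1)] by (simp add: closed_Int_compact)
  moreover have "(1 / norm z) *\<^sub>R z \<in> ?C" using z S(1) by (auto simp: subspace_scale)
  moreover have "continuous_on ?C (\<lambda>x. x \<bullet> (A *v x))"
    by (intro continuous_intros linear_continuous_on_compose[of _ _ "(*v) A"]) auto
  ultimately obtain x where x: "x \<in> ?C" and max: "\<And>y. y \<in> ?C \<Longrightarrow> y \<bullet> (A *v y) \<le> x \<bullet> (A *v x)"
    using continuous_attains_sup[of ?C "\<lambda>x. x \<bullet> (A *v x)"] by blast
  define m where "m = x \<bullet> (A *v x)"
  have xS: "x \<in> S" and xx: "x \<bullet> x = 1" using x by (auto simp: norm_eq_1)
  have bound: "v \<bullet> (A *v v) \<le> m * (v \<bullet> v)" if "v \<in> S" for v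
  proof (cases "v = 0")
    case False
    then have "(1 / norm v) *\<^sub>R v \<in> ?C" using that S(1) by (auto simp: subspace_scale)
    from max[OF this] have "(v \<bullet> (A *v v)) / (norm v)\<^sup>2 \<le> m"
      by (simp add: m_def scaleR_matrix_vector_assoc[symmetric] matrix_vector_mult_scaleR power2_eq_square)
    then show ?thesis using False by (simp add: divide_simps power2_norm_eq_inner split: if_splits)
  qed simp
  define y where "y = A *v x - m *\<^sub>R x"
  have yS: "y \<in> S" unfolding y_def using S(1) xS inv by (simp add: subspace_diff subspace_scale)
  have yx: "y \<bullet> x = 0" by (simp add: y_def inner_diff_left xx m_def inner_commute[of "A *v x"])
  have Ax: "A *v x = y + m *\<^sub>R x" by (simp add: y_def)
  have "2 * s * (y \<bullet> y) + s\<^sup>2 * (y \<bullet> (A *v y) - m * (y \<bullet> y)) \<le> 0" for s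
  proof -
    have "x \<bullet> (A *v y) = y \<bullet> y" "y \<bullet> (A *v x) = y \<bullet> y" "x \<bullet> (A *v x) = m"
      using inner_symmetric_matrix[OF A, of x y] yx by (simp_all add: Ax inner_add_left inner_add_right inner_commute xx)
    then have "(x + s *\<^sub>R y) \<bullet> (A *v (x + s *\<^sub>R y)) = m + 2 * s * (y \<bullet> y) + s\<^sup>2 * (y \<bullet> (A *v y))"
      by (simp add: matrix_vector_right_distrib matrix_vector_mult_scaleR inner_add_left inner_add_right
          power2_eq_square algebra_simps)
    moreover have "(x + s *\<^sub>R y) \<bullet> (x + s *\<^sub>R y) = 1 + s\<^sup>2 * (y \<bullet> y)"
      using yx by (simp add: inner_add_left inner_add_right inner_commute xx power2_eq_square)
    moreover have "x + s *\<^sub>R y \<in> S" using xS yS S(1) by (simp add: subspace_add subspace_scale)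
    ultimately show ?thesis using bound[of "x + s *\<^sub>R y"] by (simp add: algebra_simps)
  qed
  from linear_coefficient_zero[OF this] have "y = 0" by simp
  then show ?thesis using Ax xS xx by (auto simp: m_def norm_eq_1 intro!: bexI[of _ x])
qed

text \<open>The eigenvalue is written as the Rayleigh quotient of \<open>b\<close>, so that no
  separate function for the eigenvalues has to be carried along.\<close>

definition orthonormal_eigenvectors :: "real^'n^'n \<Rightarrow> (real^'n) set \<Rightarrow> bool" where
  "orthonormal_eigenvectors A B \<longleftrightarrow>
     pairwise orthogonal B \<and> (\<forall>b\<in>B. norm b = 1 \<and> A *v b = (b \<bullet> (A *v b)) *\<^sub>R b)"

lemma orthonormal_eigenvectors_independent: "orthonormal_eigenvectors A B \<Longrightarrow> independent B"
  unfolding orthonormal_eigenvectors_def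
  by (metis norm_zero pairwise_orthogonal_independent zero_neq_one)

text \<open>The basis has to contain the columns of \<open>U\<close> that were actually chosen, also
  when eigenvalues repeat; hence an extension and not mere existence. By symmetry of
  \<open>A\<close> the orthogonal complement of \<open>B\<close> is invariant and supplies the next
  eigenvector.\<close>

lemma orthonormal_eigenbasis_extension:
  fixes A :: "real^'n^'n"
  assumes A: "transpose A = A" and B: "orthonormal_eigenvectors A B"
  shows "\<exists>C. B \<subseteq> C \<and> orthonormal_eigenvectors A C \<and> span C = UNIV \<and> card C = CARD('n)"
  using B
proof (induction "CARD('n) - card B" arbitrary: B rule: less_induct)
  case less
  have ind: "independent B" using less.prems by (rule orthonormal_eigenvectors_independent)
  then have fin: "finite B" by (rule independent_imp_finite)
  show ?case
  proof (cases "span B = UNIV")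
    case True
    then have "card B = CARD('n)" using ind by (metis dim_UNIV dim_span_eq_card_independent DIM_cart DIM_real mult.right_neutral)
    then show ?thesis using True less.prems by blast
  next
    case False
    let ?S = "{x. \<forall>b\<in>B. orthogonal b x}"
    have S: "subspace ?S" by (rule subspace_orthogonal_to_vectors)
    obtain z where "z \<noteq> 0" "\<And>y. y \<in> span B \<Longrightarrow> orthogonal z y"
      using orthogonal_to_subspace_exists_gen[of B UNIV] False by auto
    then have "?S \<noteq> {0}" by (auto simp: orthogonal_commute span_base)
    moreover have "A *v x \<in> ?S" if "x \<in> ?S" for x
    proof -
      have "b \<bullet> (A *v x) = (b \<bullet> (A *v b)) * (b \<bullet> x)" if "b \<in> B" for b
        using less.prems that inner_symmetric_matrix[OF A, of b x]
        unfolding orthonormal_eigenvectors_def by (metis inner_scaleR_left)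
      then show ?thesis using that by (simp add: orthogonal_def)
    qed
    ultimately obtain x where x: "x \<in> ?S" "norm x = 1" "A *v x = (x \<bullet> (A *v x)) *\<^sub>R x"
      using symmetric_invariant_subspace_eigenvector[OF A S] by blast
    have xB: "x \<notin> B" using x(1,2) by (auto simp: orthogonal_self)
    have ins: "orthonormal_eigenvectors A (insert x B)"
      using less.prems x unfolding orthonormal_eigenvectors_def
      by (auto simp: pairwise_insert orthogonal_commute)
    have "card (insert x B) \<le> CARD('n)"
      using orthonormal_eigenvectors_independent[OF ins] independent_card_le by fastforce
    then have "CARD('n) - card (insert x B) < CARD('n) - card B" using fin xB by simp
    from less.hyps[OF this ins] show ?thesis by blast
  qed
qed

section \<open>Eigenvalues as roots of the characteristic polynomial\<close>

lemma poly_charpoly: "poly (charpoly A) x = det (x *\<^sub>R mat 1 - A)"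
proof -
  have "poly (charpoly A) x = det (\<chi> i j. poly ((if i = j then [:0, 1:] else 0) - [:A $ i $ j:]) x)"
    by (simp add: charpoly_def det_def poly_sum poly_prod)
  also have "(\<chi> i j. poly ((if i = j then [:0, 1:] else 0) - [:A $ i $ j:]) x) = x *\<^sub>R mat 1 - A"
    by (simp add: vec_eq_iff mat_def)
  finally show ?thesis .
qed

text \<open>Conjugation by the orthogonal matrix of the basis makes
  \<open>x *\<^sub>R mat 1 - A\<close> diagonal without changing its determinant. This ties the
  roots behind \<open>eigval\<close> to eigenvectors, with multiplicity.\<close>

lemma proots_charpoly:
  fixes A :: "real^'n^'n"
  assumes B: "orthonormal_eigenvectors A B" and card: "card B = CARD('n)"
  shows "proots (charpoly A) = image_mset (\<lambda>b. b \<bullet> (A *v b)) (mset_set B)"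
proof -
  define \<mu> where "\<mu> = (\<lambda>b. b \<bullet> (A *v b))"
  have fin: "finite B" using card by (metis card.infinite zero_less_card_finite less_numeral_extra(3))
  then obtain f :: "'n \<Rightarrow> real^'n" where f: "bij_betw f UNIV B"
    using finite_same_card_bij[of "UNIV::'n set" B] card by auto
  define P :: "real^'n^'n" where "P = (\<chi> i j. f j $ i)"
  have fB: "f i \<in> B" for i using f by (auto simp: bij_betw_def)
  have ff: "f i \<bullet> f j = (if i = j then 1 else 0)" for i j
    using B fB[of i] fB[of j] bij_betw_imp_inj_on[OF f, THEN injD, of i j]
    by (auto simp: orthonormal_eigenvectors_def norm_eq_1 pairwise_def orthogonal_def)
  have fAf: "f i \<bullet> (A *v f j) = (if i = j then \<mu> (f j) else 0)" for i j
    using B fB[of j] ff[of i j] unfolding orthonormal_eigenvectors_def \<mu>_def by (metis inner_scaleR_right mult.right_neutral mult_zero_right)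
  have PP: "transpose P ** P = mat 1"
    using ff by (simp add: vec_eq_iff matrix_matrix_mult_def transpose_def P_def mat_def inner_vec_def)
  have PAP: "transpose P ** (A ** P) = (\<chi> i j. if i = j then \<mu> (f j) else 0)"
    using fAf by (simp add: vec_eq_iff matrix_matrix_mult_def transpose_def P_def matrix_vector_mult_def inner_vec_def)
  have "poly (charpoly A) x = (\<Prod>b\<in>B. x - \<mu> b)" for x
  proof -
    have "det (transpose P) * det P = 1" by (metis PP det_I det_mul)
    then have "poly (charpoly A) x = det (transpose P) * det (x *\<^sub>R mat 1 - A) * det P"
      by (simp add: poly_charpoly algebra_simps)
    also have "\<dots> = det (transpose P ** ((x *\<^sub>R mat 1 - A) ** P))"
      by (simp add: det_mul)
    also have "transpose P ** ((x *\<^sub>R mat 1 - A) ** P) = x *\<^sub>R (transpose P ** P) - transpose P ** (A ** P)"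
      by (simp add: matrix_eq matrix_vector_mul_assoc[symmetric] matrix_vector_mult_diff_distrib matrix_vector_mult_diff_rdistrib
           scaleR_matrix_vector_assoc[symmetric] matrix_vector_mult_scaleR)
    also have "\<dots> = (\<chi> i j. if i = j then x - \<mu> (f j) else 0)"
      unfolding PP PAP by (simp add: vec_eq_iff mat_def)
    also have "det \<dots> = (\<Prod>i\<in>UNIV. x - \<mu> (f i))"
      by (subst det_diagonal) auto
    also have "\<dots> = (\<Prod>b\<in>B. x - \<mu> b)"
      by (rule prod.reindex_bij_betw[OF f])
    finally show ?thesis .
  qed
  then have "poly (charpoly A) = poly (\<Prod>b\<in>B. [:- \<mu> b, 1:])"
    by (simp add: fun_eq_iff poly_prod)
  then have "charpoly A = (\<Prod>b\<in>B. [:- \<mu> b, 1:])" by (simp only: poly_eq_poly_eq_iff)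
  then have "proots (charpoly A) = (\<Sum>b\<in>B. {#\<mu> b#})"
    by (simp add: proots_prod)
  also have "\<dots> = image_mset \<mu> (mset_set B)"
    by (metis (no_types) image_mset_cong sum_unfold_sum_mset image_mset.compositionality o_def sum_mset_singleton_mset msubset_mset_set_iff)
  finally show ?thesis by (simp add: \<mu>_def)
qed

section \<open>Optimality of the eigenvector step\<close>

text \<open>Abel summation: \<open>l\<close> is \<open>c\<close> plus nonnegative increments, and
  each increment multiplies a tail sum of \<open>x\<close>. This carries an unweighted inequality
  for the top eigenvalues over to increasing weights.\<close>

lemma sum_mult_le_of_tail_sums_nonpos:
  fixes l x :: "'a::linorder \<Rightarrow> real"
  assumes "finite A" and "\<And>a. a \<in> A \<Longrightarrow> (\<Sum>b\<in>{b\<in>A. a \<le> b}. x b) \<le> 0"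
    and "mono_on A l" and "\<And>a. a \<in> A \<Longrightarrow> c \<le> l a"
  shows "(\<Sum>a\<in>A. l a * x a) \<le> c * (\<Sum>a\<in>A. x a)"
  using assms
proof (induction A arbitrary: c rule: finite_linorder_min_induct)
  case (insert b A)
  have "b \<notin> A" using insert.hyps(2) by auto
  have tail: "{b' \<in> insert b A. a \<le> b'} = {b' \<in> A. a \<le> b'}" if "a \<in> A" for a
    using insert.hyps(2) that by fastforce
  have "(\<Sum>a\<in>A. l a * x a) \<le> l b * (\<Sum>a\<in>A. x a)"
  \<comment> \<open>The removed minimum \<open>l b\<close> becomes the new lower bound
    \<open>c\<close> for the remaining weights.\<close>
  proof (rule insert.IH)
    show "(\<Sum>b\<in>{b \<in> A. a \<le> b}. x b) \<le> 0" if "a \<in> A" for a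
      using insert.prems(1)[of a] that tail by simp
    show "mono_on A l" using insert.prems(2) by (rule mono_on_subset) auto
    show "l b \<le> l a" if "a \<in> A" for a
      using insert.prems(2) insert.hyps(2) that by (auto simp: mono_on_def)
  qed
  then have "(\<Sum>a\<in>insert b A. l a * x a) \<le> l b * (\<Sum>a\<in>insert b A. x a)"
    using insert.hyps(1) \<open>b \<notin> A\<close> by (simp add: algebra_simps)
  moreover have "{b' \<in> insert b A. b \<le> b'} = insert b A" using insert.hyps(2) by fastforce
  then have "(\<Sum>a\<in>insert b A. x a) \<le> 0" using insert.prems(1)[of b] by simp
  then have "l b * (\<Sum>a\<in>insert b A. x a) \<le> c * (\<Sum>a\<in>insert b A. x a)"
    using insert.prems(3)[of b] by (intro mult_right_mono_neg) auto
  ultimately show ?case by linarith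
qed simp

lemma bessel_inequality:
  fixes v :: "'i \<Rightarrow> 'a::real_inner"
  assumes "finite T" and "\<And>i j. i \<in> T \<Longrightarrow> j \<in> T \<Longrightarrow> v i \<bullet> v j = (if i = j then 1 else 0)"
  shows "(\<Sum>i\<in>T. (b \<bullet> v i)\<^sup>2) \<le> b \<bullet> b"
proof -
  let ?s = "\<Sum>i\<in>T. (b \<bullet> v i) *\<^sub>R v i"
  have "?s \<bullet> ?s = (\<Sum>i\<in>T. (b \<bullet> v i) * (\<Sum>j\<in>T. (b \<bullet> v j) * (v i \<bullet> v j)))"
    by (simp only: inner_sum_left inner_sum_right inner_scaleR_left inner_scaleR_right mult.assoc)
      (simp add: sum_distrib_left algebra_simps inner_commute)
  also have "\<dots> = (\<Sum>i\<in>T. (b \<bullet> v i) * (b \<bullet> v i))"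
  proof (rule sum.cong[OF refl])
    fix i assume i: "i \<in> T"
    then have "(\<Sum>j\<in>T. (b \<bullet> v j) * (v i \<bullet> v j)) = (\<Sum>j\<in>T. if i = j then b \<bullet> v j else 0)"
      using assms(2) by (intro sum.cong) auto
    then show "(b \<bullet> v i) * (\<Sum>j\<in>T. (b \<bullet> v j) * (v i \<bullet> v j)) = (b \<bullet> v i) * (b \<bullet> v i)"
      using i assms(1) by simp
  qed
  finally have "?s \<bullet> ?s = (\<Sum>i\<in>T. (b \<bullet> v i)\<^sup>2)" by (simp add: power2_eq_square)
  moreover have "b \<bullet> ?s = (\<Sum>i\<in>T. (b \<bullet> v i)\<^sup>2)"
    by (simp add: inner_sum_right power2_eq_square)
  moreover have "0 \<le> (b - ?s) \<bullet> (b - ?s)" by simp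
  ultimately show ?thesis by (simp add: inner_diff_left inner_diff_right inner_commute)
qed

lemma orthonormal_eigenvectors_expand:
  fixes A :: "real^'n^'n"
  assumes C: "orthonormal_eigenvectors A C" "span C = UNIV"
  shows "v \<bullet> v = (\<Sum>b\<in>C. (b \<bullet> v)\<^sup>2)"
    and "v \<bullet> (A *v v) = (\<Sum>b\<in>C. (b \<bullet> (A *v b)) * (b \<bullet> v)\<^sup>2)"
proof -
  have fin: "finite C" using orthonormal_eigenvectors_independent[OF C(1)] by (rule independent_imp_finite)
  have v: "(\<Sum>b\<in>C. (v \<bullet> b) *\<^sub>R b) = v"
    by (rule orthonormal_basis_expand) (use C fin in \<open>auto simp: orthonormal_eigenvectors_def\<close>)
  have "v \<bullet> v = (\<Sum>b\<in>C. (v \<bullet> b) *\<^sub>R b) \<bullet> v" unfolding v ..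
  also have "\<dots> = (\<Sum>b\<in>C. (v \<bullet> b) * (b \<bullet> v))" by (simp only: inner_sum_left inner_scaleR_left)
  finally show "v \<bullet> v = (\<Sum>b\<in>C. (b \<bullet> v)\<^sup>2)"
    by (simp add: power2_eq_square inner_commute)
  have "A *v v = (\<Sum>b\<in>C. (v \<bullet> b) *\<^sub>R (A *v b))"
    using arg_cong[OF v, of "(*v) A"] by (simp only: linear_sum[OF matrix_vector_mul_linear] matrix_vector_mult_scaleR)
  also have "\<dots> = (\<Sum>b\<in>C. (v \<bullet> b) *\<^sub>R (b \<bullet> (A *v b)) *\<^sub>R b)"
    using C(1) unfolding orthonormal_eigenvectors_def by (intro sum.cong refl arg_cong[of _ _ "(*\<^sub>R) _"]) blast
  finally show "v \<bullet> (A *v v) = (\<Sum>b\<in>C. (b \<bullet> (A *v b)) * (b \<bullet> v)\<^sup>2)"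
    by (simp add: inner_sum_right power2_eq_square inner_commute[of v] mult_ac)
qed

text \<open>Each basis vector \<open>b\<close> receives from the \<open>v i\<close> a mass between 0
  and 1 (Bessel), and the total mass is the number of vectors (Parseval). The sum is largest when
  the mass fills the vectors with the top eigenvalues. A threshold \<open>m\<close> that either side
  may attain allows ties.\<close>

lemma ky_fan_inequality:
  fixes A :: "real^'n^'n" and u v :: "'i \<Rightarrow> real^'n"
  assumes C: "orthonormal_eigenvectors A C" "span C = UNIV" and T: "finite T"
    and u: "inj_on u T" "u ` T \<subseteq> C"
    and v: "\<And>i j. i \<in> T \<Longrightarrow> j \<in> T \<Longrightarrow> v i \<bullet> v j = (if i = j then 1 else 0)"
    and top: "\<And>b. b \<in> u ` T \<Longrightarrow> m \<le> b \<bullet> (A *v b)" and rest: "\<And>b. b \<in> C - u ` T \<Longrightarrow> b \<bullet> (A *v b) \<le> m"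
  shows "(\<Sum>i\<in>T. v i \<bullet> (A *v v i)) \<le> (\<Sum>i\<in>T. u i \<bullet> (A *v u i))"
proof -
  have fin: "finite C" using orthonormal_eigenvectors_independent[OF C(1)] by (rule independent_imp_finite)
  define \<mu> s ind where "\<mu> = (\<lambda>b. b \<bullet> (A *v b))" and "s = (\<lambda>b. \<Sum>i\<in>T. (b \<bullet> v i)\<^sup>2)"
    and "ind = (\<lambda>b. if b \<in> u ` T then 1 else 0 :: real)"
  have s: "0 \<le> s b" "b \<in> C \<Longrightarrow> s b \<le> 1" for b
    using bessel_inequality[OF T v, of b] C(1)
    by (auto simp: s_def orthonormal_eigenvectors_def norm_eq_1 intro: sum_nonneg)
  have ind: "(\<Sum>b\<in>C. f b * ind b) = (\<Sum>i\<in>T. f (u i))" for f :: "real^'n \<Rightarrow> real"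
  proof -
    have "(\<Sum>b\<in>C. f b * ind b) = (\<Sum>b\<in>u ` T. f b)"
      using u(2) fin by (simp add: ind_def if_distrib sum.If_cases Int_absorb1 cong: if_cong)
    then show ?thesis by (simp add: sum.reindex[OF u(1)])
  qed
  have "(\<Sum>b\<in>C. s b) = (\<Sum>i\<in>T. \<Sum>b\<in>C. (b \<bullet> v i)\<^sup>2)" unfolding s_def by (rule sum.swap)
  also have "\<dots> = (\<Sum>i\<in>T. 1)"
    using v by (intro sum.cong) (auto simp: orthonormal_eigenvectors_expand(1)[OF C, symmetric])
  also have "\<dots> = (\<Sum>b\<in>C. ind b)" using ind[of "\<lambda>_. 1"] by simp
  finally have eq: "(\<Sum>b\<in>C. s b) = (\<Sum>b\<in>C. ind b)" .
  have "(\<Sum>i\<in>T. v i \<bullet> (A *v v i)) = (\<Sum>i\<in>T. \<Sum>b\<in>C. \<mu> b * (b \<bullet> v i)\<^sup>2)"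
    unfolding \<mu>_def by (intro sum.cong refl orthonormal_eigenvectors_expand(2)[OF C])
  also have "\<dots> = (\<Sum>b\<in>C. \<mu> b * s b)" unfolding s_def sum_distrib_left by (rule sum.swap)
  finally have "(\<Sum>i\<in>T. v i \<bullet> (A *v v i)) - (\<Sum>i\<in>T. u i \<bullet> (A *v u i)) = (\<Sum>b\<in>C. \<mu> b * s b) - (\<Sum>b\<in>C. \<mu> b * ind b)"
    by (simp add: ind \<mu>_def)
  \<comment> \<open>\<open>s\<close> and \<open>ind\<close> have the same total, so the eigenvalues may be shifted by \<open>m\<close>; then every summand is
    nonpositive.\<close>
  also have "\<dots> = (\<Sum>b\<in>C. (\<mu> b - m) * (s b - ind b)) + m * ((\<Sum>b\<in>C. s b) - (\<Sum>b\<in>C. ind b))"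
    by (simp add: algebra_simps sum.distrib sum_subtractf sum_distrib_left)
  also have "\<dots> = (\<Sum>b\<in>C. (\<mu> b - m) * (s b - ind b))" by (simp add: eq)
  also have "\<dots> \<le> 0"
  proof (rule sum_nonpos)
    fix b assume b: "b \<in> C"
    show "(\<mu> b - m) * (s b - ind b) \<le> 0"
    proof (cases "b \<in> u ` T")
      case True
      then show ?thesis using top[of b] s(2)[OF b] by (auto simp: ind_def \<mu>_def intro!: mult_nonneg_nonpos)
    next
      case False
      then show ?thesis using rest[of b] s(1)[of b] b by (auto simp: ind_def \<mu>_def intro!: mult_nonpos_nonneg)
    qed
  qed
  finally show ?thesis by simp
qed

lemma conj_diag_eq: "(transpose V ** A ** V) $ i $ i = column i V \<bullet> (A *v column i V)" for A :: "real^'n^'n"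
  unfolding matrix_mul_assoc[symmetric]
  by (simp add: matrix_vector_mult_def matrix_matrix_mult_def inner_vec_def column_def transpose_def)

lemma transpose_mult_eq_inner: "(transpose V ** V) $ i $ j = column i V \<bullet> column j V" for V :: "real^'n^'m"
  by (simp add: matrix_matrix_mult_def transpose_def column_def inner_vec_def)

text \<open>For each \<open>a\<close>, Ky Fan compares the columns from \<open>a\<close> onwards
  with the corresponding top eigenvectors; Abel summation with lower bound 0 then admits the weights
  \<open>l\<close>.\<close>

lemma U_update_maximizes:
  fixes A :: "('p::{finite,linorder}, 'p) rmat" and U V :: "('p, 'q::{finite,linorder}) rmat"
  assumes A: "transpose A = A" and card: "k + CARD('q) = CARD('p)"
    and U: "is_U_update k A U" and V: "transpose V ** V = mat 1"
    and l: "mono (($) l)" "\<And>i. 0 \<le> l $ i"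
  shows "(\<Sum>i\<in>UNIV. l $ i * (transpose V ** A ** V) $ i $ i)
       \<le> (\<Sum>i\<in>UNIV. l $ i * (transpose U ** A ** U) $ i $ i)"
proof -
  define L where "L = sorted_list_of_multiset (proots (charpoly A))"
  define u where "u a = column a U" for a
  define \<mu> where "\<mu> b = b \<bullet> (A *v b)" for b
  have U1: "transpose U ** U = mat 1" using U by (simp add: is_U_update_def)
  have uu: "u a \<bullet> u b = (if a = b then 1 else 0)" for a b
    using arg_cong[OF U1, of "\<lambda>X. X $ a $ b"] by (simp add: transpose_mult_eq_inner u_def mat_def)
  have vv: "column a V \<bullet> column b V = (if a = b then 1 else 0)" for a b
    using arg_cong[OF V, of "\<lambda>X. X $ a $ b"] by (simp add: transpose_mult_eq_inner mat_def)
  have Au: "A *v u a = L ! (k + pos a - 1) *\<^sub>R u a" for a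
    using U pos_ge_1[of a] pos_le_card[of a] unfolding is_U_update_def eigval_def L_def u_def by (metis ix_pos)
  have \<mu>u: "\<mu> (u a) = L ! (k + pos a - 1)" for a by (simp add: \<mu>_def Au uu)
  have "inj u" by (rule injI) (metis uu zero_neq_one)
  have "orthonormal_eigenvectors A (range u)"
    unfolding orthonormal_eigenvectors_def using \<mu>u Au
    by (auto simp: pairwise_def orthogonal_def uu norm_eq_1 \<mu>_def)
  from orthonormal_eigenbasis_extension[OF A this] obtain C
    where C: "range u \<subseteq> C" "orthonormal_eigenvectors A C" "span C = UNIV" "card C = CARD('p)" by blast
  have fin: "finite C" using orthonormal_eigenvectors_independent[OF C(2)] by (rule independent_imp_finite)
  have mL: "image_mset \<mu> (mset_set C) = mset L"
    using proots_charpoly[OF C(2,4)] by (simp add: L_def \<mu>_def[abs_def])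
  have lenL: "length L = CARD('p)" using arg_cong[OF mL, of size] C(4) by simp
  have sortL: "sorted L" by (simp add: L_def)
  have "drop k L = map (\<lambda>n. L ! (k + n - 1)) [1..<Suc CARD('q)]"
    by (rule nth_equalityI) (auto simp: lenL card[symmetric] simp del: upt_Suc)
  then have "mset (drop k L) = image_mset (\<lambda>n. L ! (k + n - 1)) (mset_set {1..CARD('q)})"
    by (simp add: atLeastLessThanSuc_atLeastAtMost del: upt_Suc)
  also have "\<dots> = image_mset (\<lambda>n. \<mu> (u (ix n))) (mset_set {1..CARD('q)})"
    by (rule image_mset_cong) (simp add: \<mu>u pos_ix)
  also have "\<dots> = image_mset \<mu> (image_mset u (image_mset ix (mset_set {1..CARD('q)})))"
    by (simp add: image_mset.compositionality o_def)
  also have "\<dots> = image_mset \<mu> (mset_set (range u))"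
    using bij_ix[where 'a='q] \<open>inj u\<close> by (simp add: image_mset_mset_set bij_betw_def)
  finally have dropL: "image_mset \<mu> (mset_set (range u)) = mset (drop k L)" ..
  \<comment> \<open>The whole basis carries the list \<open>L\<close> and the columns of
    \<open>U\<close> carry its end \<open>drop k L\<close>; cancelling leaves
    \<open>take k L\<close> for the other basis vectors, so these have the smaller
    eigenvalues.\<close>
  have "mset_set C = mset_set (C - range u) + mset_set (range u)"
    using fin C(1) by (subst mset_set_Union[symmetric]) (auto simp: Un_absorb2 finite_subset)
  then have "image_mset \<mu> (mset_set (C - range u)) + mset (drop k L) = mset (take k L) + mset (drop k L)"
    using mL dropL by (simp flip: mset_append)
  then have takeL: "image_mset \<mu> (mset_set (C - range u)) = mset (take k L)" by simp
  have low: "\<mu> b \<le> \<mu> (u a)" if "b \<in> C - range u" for a b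
  proof -
    have "\<mu> b \<in># mset (take k L)" unfolding takeL[symmetric] using that fin by simp
    then obtain n where n: "n < k" "n < length L" "\<mu> b = L ! n" by (auto simp: in_set_conv_nth)
    show ?thesis unfolding \<mu>u n(3)
      by (rule sorted_nth_mono[OF sortL]) (use n pos_ge_1[of a] pos_le_card[of a] card lenL in auto)
  qed
  have mono: "\<mu> (u a) \<le> \<mu> (u b)" if "a \<le> b" for a b
  proof -
    have "pos a \<le> pos b" using that by (auto simp: order_le_less dest: pos_less)
    then show ?thesis unfolding \<mu>u
      by (intro sorted_nth_mono[OF sortL]) (use pos_ge_1[of b] pos_le_card[of b] card lenL in auto)
  qed
  have tail: "(\<Sum>b | b \<in> UNIV \<and> a \<le> b. \<mu> (column b V) - \<mu> (u b)) \<le> 0" for a :: 'q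
  proof -
    have "(\<Sum>b | a \<le> b. column b V \<bullet> (A *v column b V)) \<le> (\<Sum>b | a \<le> b. u b \<bullet> (A *v u b))"
    proof (rule ky_fan_inequality[OF C(2,3), where m = "\<mu> (u a)"])
      show "\<mu> (u a) \<le> b \<bullet> (A *v b)" if "b \<in> u ` {b. a \<le> b}" for b
        using that mono unfolding \<mu>_def by auto
      show "b \<bullet> (A *v b) \<le> \<mu> (u a)" if "b \<in> C - u ` {b. a \<le> b}" for b
      proof (cases "b \<in> range u")
        case True
        then obtain c where "b = u c" by auto
        moreover from this that have "c < a" by auto
        ultimately show ?thesis using mono[of c a] by (simp add: \<mu>_def)
      next
        case False then show ?thesis using that low[of b a] by (auto simp: \<mu>_def)
      qed
      show "inj_on u {b. a \<le> b}" using \<open>inj u\<close> by (rule inj_on_subset) simp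
    qed (use C(1) vv in auto)
    then show ?thesis by (simp add: \<mu>_def sum_subtractf)
  qed
  have "(\<Sum>a\<in>UNIV. l $ a * (\<mu> (column a V) - \<mu> (u a))) \<le> 0 * (\<Sum>a\<in>UNIV. \<mu> (column a V) - \<mu> (u a))"
    by (rule sum_mult_le_of_tail_sums_nonpos) (use tail l in auto)
  then show ?thesis by (simp add: conj_diag_eq \<mu>_def u_def sum_subtractf right_diff_distrib)
qed

section \<open>Derivatives of the Lagrangian and multipliers\<close>

lemma inner_matrix_mult_right: "A \<bullet> (B ** C) = (A ** transpose C) \<bullet> B"
  for A :: "real^'n^'m" and B :: "real^'k^'m" and C :: "real^'n^'k"
proof -
  have "A \<bullet> (B ** C) = (\<Sum>i\<in>UNIV. \<Sum>j\<in>UNIV. \<Sum>k\<in>UNIV. A $ i $ j * (B $ i $ k * C $ k $ j))"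
    by (simp add: inner_vec_def matrix_matrix_mult_def sum_distrib_left)
  also have "\<dots> = (\<Sum>i\<in>UNIV. \<Sum>k\<in>UNIV. \<Sum>j\<in>UNIV. A $ i $ j * (B $ i $ k * C $ k $ j))"
    by (intro sum.cong refl sum.swap)
  also have "\<dots> = (A ** transpose C) \<bullet> B"
    by (simp add: inner_vec_def matrix_matrix_mult_def transpose_def sum_distrib_right sum_distrib_left algebra_simps)
  finally show ?thesis .
qed

lemma inner_transpose: "transpose A \<bullet> transpose B = A \<bullet> B" for A B :: "real^'n^'m"
  unfolding inner_vec_def transpose_def by simp (rule sum.swap)

lemma inner_matrix_mult_left: "A \<bullet> (B ** C) = (transpose B ** A) \<bullet> C"
  for A :: "real^'n^'m" and B :: "real^'k^'m" and C :: "real^'n^'k"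
proof -
  have "A \<bullet> (B ** C) = transpose A \<bullet> (transpose C ** transpose B)"
    by (simp add: inner_transpose flip: matrix_transpose_mul)
  also have "\<dots> = transpose (transpose B ** A) \<bullet> transpose C"
    by (simp add: inner_matrix_mult_right matrix_transpose_mul)
  finally show ?thesis by (simp add: inner_transpose)
qed

lemma inner_Diag: "X \<bullet> Diag l = (\<chi> i. X $ i $ i) \<bullet> l"
  by (simp add: inner_vec_def Diag_def if_distrib cong: if_cong)

lemma transpose_Diag: "transpose (Diag l) = Diag l"
  by (auto simp: transpose_def Diag_def vec_eq_iff)

lemma matrix_mult_Diag: "(A ** Diag b) $ i $ j = A $ i $ j * b $ j"
proof -
  have "(A ** Diag b) $ i $ j = (\<Sum>k\<in>UNIV. if k = j then A $ i $ k * b $ k else 0)"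
    unfolding matrix_matrix_mult_def Diag_def by (simp add: if_distrib cong: if_cong)
  then show ?thesis by simp
qed

lemma linear_Diag: "linear Diag"
  by (rule linearI) (auto simp: Diag_def vec_eq_iff)

lemma linear_transpose: "linear (transpose :: real^'n^'m \<Rightarrow> real^'m^'n)"
  by (rule linearI) (auto simp: transpose_def vec_eq_iff)

text \<open>For \<open>A = Lap w\<close> this is the target vector d of the eigenvalue
  update.\<close>

definition conj_diag :: "('p::finite, 'p) rmat \<Rightarrow> ('p, 'q::finite) rmat \<Rightarrow> 'q rvec" where
  "conj_diag A U = (\<chi> i. (transpose U ** A ** U) $ i $ i)"

lemma inner_conj_Diag: "A \<bullet> (U ** Diag l ** transpose U) = conj_diag A U \<bullet> l"
proof -
  have "A \<bullet> (U ** Diag l ** transpose U) = (transpose U ** A ** U) \<bullet> Diag l"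
    by (simp only: inner_matrix_mult_right[of A "U ** Diag l" "transpose U"] transpose_transpose
        inner_matrix_mult_left[of "A ** U" U "Diag l"] matrix_mul_assoc)
  then show ?thesis by (simp add: inner_Diag conj_diag_def)
qed

text \<open>For orthonormal columns the matrix \<open>U ** Diag l ** transpose U\<close> has the
  norm of \<open>l\<close>. So \<open>U\<close> enters only through the linear term, which turns its
  step into a maximisation, and completing the square in \<open>l\<close> gives the quadratic of the
  \<open>l\<close>-subproblem.\<close>

lemma norm_residual:
  fixes U :: "('p::finite, 'q::finite) rmat"
  assumes "transpose U ** U = mat 1"
  shows "(norm (A - U ** Diag l ** transpose U))\<^sup>2 = (norm A)\<^sup>2 - 2 * (conj_diag A U \<bullet> l) + l \<bullet> l"
proof -
  have "transpose U ** (U ** Diag l ** transpose U) ** U = (transpose U ** U) ** Diag l ** (transpose U ** U)"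
    by (simp add: matrix_mul_assoc)
  then have "conj_diag (U ** Diag l ** transpose U) U = l"
    by (simp add: assms conj_diag_def Diag_def vec_eq_iff)
  then have "(U ** Diag l ** transpose U) \<bullet> (U ** Diag l ** transpose U) = l \<bullet> l"
    unfolding inner_conj_Diag by simp
  moreover have "(norm (A - Y))\<^sup>2 = (norm A)\<^sup>2 - 2 * (A \<bullet> Y) + Y \<bullet> Y" for Y
    unfolding power2_norm_eq_inner by (simp add: inner_diff_left inner_diff_right inner_commute)
  ultimately show ?thesis by (simp add: inner_conj_Diag)
qed

section \<open>Gradients of the Lagrangian block by block\<close>

lemma bounded_bilinear_matrix_matrix_mult:
  "bounded_bilinear ((**) :: real^'k^'m \<Rightarrow> real^'n^'k \<Rightarrow> real^'n^'m)"
  unfolding bilinear_conv_bounded_bilinear[symmetric] bilinear_def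
  by (auto intro!: linearI simp: matrix_matrix_mult_def vec_eq_iff sum_distrib_left algebra_simps sum.distrib)

lemma bounded_linear_matrix_simps:
  "bounded_linear (Lap :: 'e::{finite,linorder} rvec \<Rightarrow> ('p::{finite,linorder}, 'p) rmat)"
  "bounded_linear (Diag :: 'q::finite rvec \<Rightarrow> ('q, 'q) rmat)"
  "bounded_linear (transpose :: real^'n^'m \<Rightarrow> real^'m^'n)"
  "bounded_linear (adjoint Lap :: ('p, 'p) rmat \<Rightarrow> 'e rvec)"
  by (simp_all add: linear_conv_bounded_linear[symmetric] linear_Lap linear_Diag linear_transpose adjoint_linear)

text \<open>Pairing with a direction moves the adjoint onto \<open>h\<close>, so its explicit form
  never matters. Up to the factor \<open>1 / \<beta>\<close> this is the derivative of the objective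
  in \<open>w\<close>.\<close>

lemma inner_grad_w:
  "h \<bullet> grad_w K \<beta> w l U = Lap h \<bullet> (Lap w - U ** Diag l ** transpose U) + (1 / \<beta>) * (Lap h \<bullet> K)"
  unfolding grad_w_def by (simp add: inner_diff_right adjoint_works[OF linear_Lap])

lemma objective_eq:
  assumes "transpose K = K"
  shows "objective K \<beta> w l U = - (\<Sum>i\<in>UNIV. ln (l $ i)) + K \<bullet> Lap w
     + \<beta> / 2 * ((Lap w - U ** Diag l ** transpose U) \<bullet> (Lap w - U ** Diag l ** transpose U))"
  unfolding objective_def trace_mult_eq_inner power2_norm_eq_inner assms ..

lemma has_derivative_half_inner_self:
  assumes "(g has_derivative g') (at x)"
  shows "((\<lambda>x. c / 2 * (g x \<bullet> g x)) has_derivative (\<lambda>h. c * (g x \<bullet> g' h))) (at x)"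
  by (rule has_derivative_mult_right[OF has_derivative_inner[OF assms assms], THEN has_derivative_eq_rhs])
    (simp add: fun_eq_iff inner_commute)

lemma gderiv_lagrangian_w:
  fixes K :: "('p::{finite,linorder}, 'p) rmat" and w :: "'e::{finite,linorder} rvec"
  assumes K: "transpose K = K" and "\<beta> \<noteq> 0"
  shows "GDERIV (\<lambda>w'. lagrangian K \<beta> c1 c2 \<mu> \<nu> M w' l U) w :> \<beta> *\<^sub>R grad_w K \<beta> w l U - \<mu>"
proof -
  let ?Y = "U ** Diag l ** transpose U"
  have Lap: "(Lap has_derivative (Lap :: 'e rvec \<Rightarrow> ('p, 'p) rmat)) (at w)"
    using bounded_linear_matrix_simps(1) by (rule bounded_linear_imp_has_derivative)
  define f where "f w' = K \<bullet> Lap w' + \<beta> / 2 * ((Lap w' - ?Y) \<bullet> (Lap w' - ?Y)) - \<mu> \<bullet> w'" for w'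
  \<comment> \<open>Evaluating at 0 names the part that does not depend on \<open>w'\<close> without
    writing it out.\<close>
  define C where "C = lagrangian K \<beta> c1 c2 \<mu> \<nu> M 0 l U - f 0"
  have eq: "lagrangian K \<beta> c1 c2 \<mu> \<nu> M w' l U = f w' + C" for w'
    unfolding C_def f_def lagrangian_def objective_eq[OF K] by simp
  have "((\<lambda>w'. Lap w' - ?Y) has_derivative Lap) (at w)"
    using has_derivative_diff[OF Lap has_derivative_const[of ?Y]] by simp
  note sq = has_derivative_half_inner_self[OF this, of \<beta>]
  have "(f has_derivative (\<lambda>h. K \<bullet> Lap h + \<beta> * ((Lap w - ?Y) \<bullet> Lap h) - \<mu> \<bullet> h)) (at w)"
    unfolding f_def
    using has_derivative_diff[OF has_derivative_add[OF has_derivative_inner_right[OF Lap, of K] sq]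
        has_derivative_inner_right[OF has_derivative_ident, of \<mu>]] by simp
  moreover have "K \<bullet> Lap h + \<beta> * ((Lap w - ?Y) \<bullet> Lap h) - \<mu> \<bullet> h = h \<bullet> (\<beta> *\<^sub>R grad_w K \<beta> w l U - \<mu>)" for h
    using assms(2) by (simp add: inner_diff_right[of h] inner_grad_w inner_commute[of K] inner_commute[of \<mu>]
        inner_commute[of "Lap w - ?Y"] distrib_left)
  ultimately show ?thesis
    unfolding gderiv_def eq by (simp add: has_derivative_add_const)
qed

text \<open>Collecting the coefficient of each entry of \<open>l\<close> explains the differences of
  neighbouring multipliers in the gradient.\<close>

lemma sum_by_parts_chain:
  fixes \<nu> l :: "nat \<Rightarrow> real"
  assumes "1 \<le> q"
  shows "\<nu> 0 * (c1 - l 1) + (\<Sum>i = 1..<q. \<nu> i * (l i - l (i + 1))) + \<nu> q * (l q - c2)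
     = (\<Sum>n = 1..q. l n * (\<nu> n - \<nu> (n - 1))) + (\<nu> 0 * c1 - \<nu> q * c2)"
  using assms by (induction q rule: dec_induct) (simp_all add: algebra_simps)

lemma lagrangian_l_eq:
  fixes U :: "('p::{finite,linorder}, 'q::{finite,linorder}) rmat"
  assumes U: "transpose U ** U = mat 1"
  shows "lagrangian K \<beta> c1 c2 \<mu> \<nu> M w l U =
    - (\<Sum>i\<in>UNIV. ln (l $ i)) + \<beta> / 2 * (l \<bullet> l) - \<beta> * (conj_diag (Lap w) U \<bullet> l)
    + l \<bullet> (\<chi> a. \<nu> (pos a) - \<nu> (pos a - 1))
    + (trace (K ** Lap w) + \<beta> / 2 * (norm (Lap w :: ('p, 'p) rmat))\<^sup>2 - \<mu> \<bullet> w + (\<nu> 0 * c1 - \<nu> CARD('q) * c2)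
       + trace (M ** (transpose U ** U - mat 1)))"
proof -
  have "l \<bullet> (\<chi> a. \<nu> (pos a) - \<nu> (pos a - 1)) = (\<Sum>n = 1..CARD('q). l $ ix n * (\<nu> n - \<nu> (n - 1)))"
    by (simp add: inner_vec_def sum_ix[symmetric] pos_ix)
  then have "\<nu> 0 * (c1 - l $ ix 1) + (\<Sum>i = 1..<CARD('q). \<nu> i * (l $ ix i - l $ ix (i + 1)))
       + \<nu> CARD('q) * (l $ ix CARD('q) - c2)
     = l \<bullet> (\<chi> a. \<nu> (pos a) - \<nu> (pos a - 1)) + (\<nu> 0 * c1 - \<nu> CARD('q) * c2)"
    by (subst sum_by_parts_chain[of "CARD('q)" \<nu> c1 "\<lambda>n. l $ ix n" c2]) (simp_all add: Suc_le_eq)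
  then show ?thesis
    unfolding lagrangian_def objective_def norm_residual[OF U] by (simp add: algebra_simps)
qed

lemma gderiv_lagrangian_l:
  fixes U :: "('p::{finite,linorder}, 'q::{finite,linorder}) rmat"
  assumes U: "transpose U ** U = mat 1" and l: "\<And>i. 0 < l $ i"
  shows "GDERIV (\<lambda>l'. lagrangian K \<beta> c1 c2 \<mu> \<nu> M w l' U) l :>
    (\<chi> a. - 1 / l $ a + \<beta> * (l $ a - conj_diag (Lap w) U $ a) + (\<nu> (pos a) - \<nu> (pos a - 1)))"
proof -
  have nth: "((\<lambda>l'. l' $ i) has_derivative (\<lambda>h. h $ i)) (at l)" for i :: 'q
    by (rule bounded_linear_imp_has_derivative[OF bounded_linear_vec_nth])
  have "((\<lambda>l'. - (\<Sum>i\<in>UNIV. ln (l' $ i))) has_derivative (\<lambda>h. - (\<Sum>i\<in>UNIV. h $ i / l $ i))) (at l)"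
    by (intro has_derivative_minus has_derivative_sum)
      (use l in \<open>auto intro!: has_derivative_eq_rhs[OF has_derivative_ln[OF _ nth]] simp: fun_eq_iff divide_inverse\<close>)
  from has_derivative_add[OF has_derivative_diff[OF has_derivative_add[OF this
        has_derivative_half_inner_self[OF has_derivative_ident, of \<beta>]]
        has_derivative_mult_right[OF has_derivative_inner_right[OF has_derivative_ident]]]
        has_derivative_inner_left[OF has_derivative_ident]]
  have "((\<lambda>l'. - (\<Sum>i\<in>UNIV. ln (l' $ i)) + \<beta> / 2 * (l' \<bullet> l') - \<beta> * (conj_diag (Lap w) U \<bullet> l')
    + l' \<bullet> (\<chi> a. \<nu> (pos a) - \<nu> (pos a - 1))) has_derivative
    (\<lambda>h. - (\<Sum>i\<in>UNIV. h $ i / l $ i) + \<beta> * (l \<bullet> h) - \<beta> * (conj_diag (Lap w) U \<bullet> h)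
       + h \<bullet> (\<chi> a. \<nu> (pos a) - \<nu> (pos a - 1)))) (at l)" .
  then have "((\<lambda>l'. lagrangian K \<beta> c1 c2 \<mu> \<nu> M w l' U) has_derivative
    (\<lambda>h. - (\<Sum>i\<in>UNIV. h $ i / l $ i) + \<beta> * (l \<bullet> h) - \<beta> * (conj_diag (Lap w) U \<bullet> h)
       + h \<bullet> (\<chi> a. \<nu> (pos a) - \<nu> (pos a - 1)))) (at l)"
    unfolding lagrangian_l_eq[OF U] by (rule has_derivative_add_const)
  moreover have "- (\<Sum>i\<in>UNIV. h $ i / l $ i) + \<beta> * (l \<bullet> h) - \<beta> * (conj_diag (Lap w) U \<bullet> h)
       + h \<bullet> (\<chi> a. \<nu> (pos a) - \<nu> (pos a - 1)) =
      h \<bullet> (\<chi> a. - 1 / l $ a + \<beta> * (l $ a - conj_diag (Lap w) U $ a) + (\<nu> (pos a) - \<nu> (pos a - 1)))" for h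
    unfolding inner_vec_def sum_distrib_left sum_negf[symmetric] sum.distrib[symmetric] sum_subtractf[symmetric]
    by (rule sum.cong) (simp_all add: algebra_simps)
  ultimately show ?thesis unfolding gderiv_def by simp
qed

text \<open>The residual and \<open>M\<close> are symmetric, so the two terms of each product rule
  agree, hence the factors 2. Since \<open>U'\<close> ranges over all matrices, the shortened
  residual for orthonormal columns cannot be used here.\<close>

lemma gderiv_lagrangian_U:
  fixes U :: "('p::{finite,linorder}, 'q::{finite,linorder}) rmat" and w :: "'e::{finite,linorder} rvec"
  assumes M: "transpose M = M"
  shows "GDERIV (\<lambda>U'. lagrangian K \<beta> c1 c2 \<mu> \<nu> M w l U') U :>
     2 *\<^sub>R (U ** M) - (2 * \<beta>) *\<^sub>R ((Lap w - U ** Diag l ** transpose U) ** U ** Diag l)"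
proof -
  let ?Z = "Lap w - U ** Diag l ** transpose U"
  note mm = bounded_bilinear.FDERIV[OF bounded_bilinear_matrix_matrix_mult]
  have tr: "(transpose has_derivative transpose) (at U)"
    using bounded_linear_matrix_simps(3) by (rule bounded_linear_imp_has_derivative)
  have Zt: "transpose ?Z = ?Z"
    by (simp add: linear_diff[OF linear_transpose] transpose_Lap matrix_transpose_mul transpose_Diag matrix_mul_assoc)
  have Z: "?Z \<bullet> (h ** Diag l ** transpose U) = h \<bullet> (?Z ** U ** Diag l)"
    "?Z \<bullet> (U ** Diag l ** transpose h) = h \<bullet> (?Z ** U ** Diag l)" for h
  proof -
    show 1: "?Z \<bullet> (h ** Diag l ** transpose U) = h \<bullet> (?Z ** U ** Diag l)"
      by (simp add: inner_matrix_mult_right transpose_Diag matrix_mul_assoc inner_commute)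
    have "?Z \<bullet> (U ** Diag l ** transpose h) = transpose ?Z \<bullet> transpose (U ** Diag l ** transpose h)"
      by (simp add: inner_transpose)
    also have "\<dots> = ?Z \<bullet> (h ** Diag l ** transpose U)"
      unfolding Zt by (simp add: matrix_transpose_mul transpose_Diag matrix_mul_assoc)
    finally show "?Z \<bullet> (U ** Diag l ** transpose h) = h \<bullet> (?Z ** U ** Diag l)" using 1 by simp
  qed
  have MU: "M \<bullet> (transpose U ** h) = h \<bullet> (U ** M)" "M \<bullet> (transpose h ** U) = h \<bullet> (U ** M)" for h
  proof -
    show 1: "M \<bullet> (transpose U ** h) = h \<bullet> (U ** M)"
      unfolding inner_matrix_mult_left[of M "transpose U" h] transpose_transpose by (rule inner_commute)
    have "M \<bullet> (transpose h ** U) = transpose M \<bullet> transpose (transpose h ** U)"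
      by (simp add: inner_transpose)
    then show "M \<bullet> (transpose h ** U) = h \<bullet> (U ** M)"
      using 1 by (simp add: M matrix_transpose_mul)
  qed
  have dU: "((\<lambda>U'. U' ** Diag l ** transpose U') has_derivative
      (\<lambda>h. U ** Diag l ** transpose h + h ** Diag l ** transpose U)) (at U)"
    by (rule mm[OF mm[OF has_derivative_ident has_derivative_const] tr, THEN has_derivative_eq_rhs])
      (simp add: fun_eq_iff matrix_matrix_mult_def vec_eq_iff)
  have dG: "((\<lambda>U'. transpose U' ** U') has_derivative (\<lambda>h. transpose U ** h + transpose h ** U)) (at U)"
    by (rule mm[OF tr has_derivative_ident])
  define f where "f U' = \<beta> / 2 * ((Lap w - U' ** Diag l ** transpose U') \<bullet> (Lap w - U' ** Diag l ** transpose U'))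
    + M \<bullet> (transpose U' ** U' - mat 1)" for U' :: "('p, 'q) rmat"
  define C where "C = lagrangian K \<beta> c1 c2 \<mu> \<nu> M w l 0 - f 0"
  have eq: "lagrangian K \<beta> c1 c2 \<mu> \<nu> M w l U' = f U' + C" for U' :: "('p, 'q) rmat"
    unfolding C_def f_def lagrangian_def objective_def power2_norm_eq_inner trace_mult_eq_inner[of M] M by simp
  have "((\<lambda>U'. Lap w - U' ** Diag l ** transpose U') has_derivative
      (\<lambda>h. - (U ** Diag l ** transpose h + h ** Diag l ** transpose U))) (at U)"
    using has_derivative_diff[OF has_derivative_const dU] by simp
  note sq = has_derivative_half_inner_self[OF this, of \<beta>]
  have G: "((\<lambda>U'. transpose U' ** U' - mat 1) has_derivative (\<lambda>h. transpose U ** h + transpose h ** U)) (at U)"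
    using has_derivative_diff[OF dG has_derivative_const] by simp
  have "(f has_derivative (\<lambda>h. \<beta> * (?Z \<bullet> - (U ** Diag l ** transpose h + h ** Diag l ** transpose U))
      + M \<bullet> (transpose U ** h + transpose h ** U))) (at U)"
    unfolding f_def by (rule has_derivative_add[OF sq has_derivative_inner_right[OF G]])
  moreover have "\<beta> * (?Z \<bullet> - (U ** Diag l ** transpose h + h ** Diag l ** transpose U))
      + M \<bullet> (transpose U ** h + transpose h ** U)
     = h \<bullet> (2 *\<^sub>R (U ** M) - (2 * \<beta>) *\<^sub>R (?Z ** U ** Diag l))" for h
    unfolding inner_minus_right inner_add_right Z MU inner_diff_right inner_scaleR_right by (simp add: algebra_simps)
  ultimately show ?thesis
    unfolding gderiv_def eq by (simp add: has_derivative_add_const)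
qed

text \<open>Stationarity forces \<open>\<nu> n = \<nu> 0 - R n\<close> with \<open>R\<close> the partial sums of \<open>r\<close>. Moving the slack of
  a non-tight constraint \<open>n\<close> to another constraint \<open>j\<close> keeps the point feasible, and optimality then gives
  \<open>R j \<le> R n\<close>; hence \<open>\<nu> 0 = Max R\<close> makes all multipliers nonnegative and complementary.\<close>

lemma chain_multipliers:
  fixes l :: "'q::{finite,linorder} rvec" and r :: "'q \<Rightarrow> real"
  assumes l: "l \<in> chain_set c1 c2"
    and opt: "\<And>x. x \<in> chain_set c1 c2 \<Longrightarrow> 0 \<le> (\<Sum>a\<in>UNIV. r a * (x $ a - l $ a))"
  shows "\<exists>\<nu>. (\<forall>i \<le> CARD('q). 0 \<le> \<nu> i) \<and> \<nu> 0 * (c1 - l $ ix 1) = 0 \<and>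
     (\<forall>i. 1 \<le> i \<and> i < CARD('q) \<longrightarrow> \<nu> i * (l $ ix i - l $ ix (i + 1)) = 0) \<and>
     \<nu> CARD('q) * (l $ ix CARD('q) - c2) = 0 \<and> (\<forall>a. \<nu> (pos a) - \<nu> (pos a - 1) = - r a)"
proof -
  let ?q = "CARD('q)"
  have q: "1 \<le> ?q" by (simp add: Suc_le_eq)
  define R where "R n = (\<Sum>i = 1..n. r (ix i))" for n
  define \<nu> where "\<nu> n = Max (R ` {0..?q}) - R n" for n
  \<comment> \<open>The slack of constraint \<open>n\<close>, with \<open>c1\<close> put before the
    first entry and \<open>c2\<close> after the last, so that both bounds are treated like the chain
    inequalities.\<close>
  define gap where "gap n = (if n = ?q then c2 else l $ ix (n + 1)) - (if n = 0 then c1 else l $ ix n)" for n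
  have l1: "c1 \<le> l $ ix 1" and lq: "l $ ix ?q \<le> c2"
    and ls: "\<And>i. 1 \<le> i \<Longrightarrow> i < ?q \<Longrightarrow> l $ ix i \<le> l $ ix (i + 1)"
    using l unfolding chain_set_def mem_Collect_eq by auto
  have block: "(\<Sum>a\<in>UNIV. r a * (if n < pos a \<and> pos a \<le> j then g else 0)) = g * (R j - R n)"
    if "n \<le> j" "j \<le> ?q" for n j g
  proof -
    have "(\<Sum>a\<in>UNIV. r a * (if n < pos a \<and> pos a \<le> j then g else 0))
        = (\<Sum>i = 1..?q. if n < i \<and> i \<le> j then g * r (ix i) else 0)"
      unfolding sum_ix[symmetric] by (rule sum.cong) (auto simp: pos_ix)
    also have "\<dots> = (\<Sum>i \<in> {i \<in> {1..?q}. n < i \<and> i \<le> j}. g * r (ix i))"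
      by (rule sum.inter_filter[symmetric]) simp
    also have "{i \<in> {1..?q}. n < i \<and> i \<le> j} = {1..j} - {1..n}" using that by auto
    also have "(\<Sum>i \<in> {1..j} - {1..n}. g * r (ix i)) = g * (R j - R n)"
      unfolding R_def using that by (subst sum_diff) (auto simp: sum_distrib_left right_diff_distrib)
    finally show ?thesis .
  qed
  have max: "R j \<le> R n" if n: "n \<le> ?q" and g: "0 < gap n" and j: "j \<le> ?q" for n j
  proof (cases "n < j")
    case True
    \<comment> \<open>Lowering the entries \<open>n + 1\<close> to \<open>j\<close> closes gap
      \<open>n\<close> and widens gap \<open>j\<close> by the same amount.\<close>
    define x where "x = (\<chi> a. l $ a + (if n < pos a \<and> pos a \<le> j then - gap n else 0))"
    have x: "x $ ix i = l $ ix i + (if n < i \<and> i \<le> j then - gap n else 0)" if "1 \<le> i" "i \<le> ?q" for i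
      using that by (simp add: x_def pos_ix)
    have "x \<in> chain_set c1 c2"
      unfolding chain_set_def mem_Collect_eq
    proof (intro conjI allI impI)
      show "c1 \<le> x $ ix 1" using l1 True j q by (simp add: x gap_def del: One_nat_def)
      show "x $ ix ?q \<le> c2" using lq g q by (simp add: x)
      fix i assume i: "1 \<le> i \<and> i < ?q"
      show "x $ ix i \<le> x $ ix (i + 1)"
      proof (cases "i = n")
        case True
        then show ?thesis using i g \<open>n < j\<close> by (simp add: x gap_def)
      next
        case False
        then show ?thesis using i ls[of i] g by (auto simp: x)
      qed
    qed
    from opt[OF this] have "0 \<le> - gap n * (R j - R n)"
      using block[of n j "- gap n"] True j by (simp add: x_def)
    then show ?thesis using g by (simp add: mult_le_0_iff zero_le_mult_iff)
  next
    case False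
    \<comment> \<open>The mirror case: raising the entries \<open>j + 1\<close> to \<open>n\<close>
      closes gap \<open>n\<close>.\<close>
    define x where "x = (\<chi> a. l $ a + (if j < pos a \<and> pos a \<le> n then gap n else 0))"
    have x: "x $ ix i = l $ ix i + (if j < i \<and> i \<le> n then gap n else 0)" if "1 \<le> i" "i \<le> ?q" for i
      using that by (simp add: x_def pos_ix)
    have "x \<in> chain_set c1 c2"
      unfolding chain_set_def mem_Collect_eq
    proof (intro conjI allI impI)
      show "c1 \<le> x $ ix 1" using l1 q g by (simp add: x del: One_nat_def)
      show "x $ ix ?q \<le> c2" using lq n q by (auto simp: x gap_def)
      fix i assume i: "1 \<le> i \<and> i < ?q"
      show "x $ ix i \<le> x $ ix (i + 1)"
      proof (cases "i = n")
        case True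
        then show ?thesis using i g by (simp add: x gap_def)
      next
        case False
        then show ?thesis using i ls[of i] g by (auto simp: x)
      qed
    qed
    from opt[OF this] have "0 \<le> gap n * (R n - R j)"
      using block[of j n "gap n"] False n by (simp add: x_def)
    then show ?thesis using g by (simp add: zero_le_mult_iff)
  qed
  have nonneg: "0 \<le> \<nu> i" if "i \<le> ?q" for i
    unfolding \<nu>_def using that by simp
  have comp: "\<nu> i * gap i = 0" if i: "i \<le> ?q" for i
  proof -
    have "0 \<le> gap i"
      using l1 lq ls[of i] i q by (auto simp: gap_def)
    moreover have "\<nu> i = 0" if "0 < gap i"
    proof -
      have "Max (R ` {0..?q}) \<le> R i" by (rule Max.boundedI) (use max[OF i that] in auto)
      then show ?thesis using nonneg[OF i] unfolding \<nu>_def by linarith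
    qed
    ultimately show ?thesis by (cases "gap i = 0") auto
  qed
  have "\<nu> (pos a) - \<nu> (pos a - 1) = - r a" for a
  proof -
    obtain n where n: "pos a = Suc n" using pos_ge_1[of a] by (cases "pos a") auto
    then have "ix (Suc n) = a" by (metis ix_pos)
    then show ?thesis by (simp add: n \<nu>_def R_def)
  qed
  moreover have "\<nu> 0 * (c1 - l $ ix 1) = 0" "\<nu> ?q * (l $ ix ?q - c2) = 0"
    using comp[of 0] comp[of ?q] q by (auto simp: gap_def)
  moreover have "\<nu> i * (l $ ix i - l $ ix (i + 1)) = 0" if "1 \<le> i \<and> i < ?q" for i
    using comp[of i] that by (auto simp: gap_def)
  ultimately show ?thesis using nonneg by blast
qed

section \<open>Descent and limit points\<close>

lemma chain_set_segment:
  fixes l x :: "'q::{finite,linorder} rvec"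
  assumes "l \<in> chain_set c1 c2" "x \<in> chain_set c1 c2" "0 \<le> s" "s \<le> 1"
  shows "l + s *\<^sub>R (x - l) \<in> chain_set c1 c2"
proof -
  have *: "a + s * (a' - a) \<le> b + s * (b' - b)" if "a \<le> b" "a' \<le> b'" for a a' b b' :: real
  proof -
    have "(1 - s) * a + s * a' \<le> (1 - s) * b + s * b'"
      using that assms(3,4) by (intro add_mono mult_left_mono) auto
    then show ?thesis by (simp add: algebra_simps)
  qed
  from assms(1,2) *[of c1 _ c1] *[of _ c2 _ c2] * show ?thesis
    unfolding chain_set_def mem_Collect_eq by simp
qed

lemma log_quadratic_deriv:
  fixes y :: real
  assumes "0 < y"
  shows "((\<lambda>s. - ln (y + s * e) + \<beta> / 2 * (y + s * e - d)\<^sup>2)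
    has_real_derivative (- 1 / y + \<beta> * (y - d)) * e) (at 0)"
proof -
  have u: "((\<lambda>s. y + s * e) has_real_derivative e) (at 0)"
    by (auto intro!: derivative_eq_intros)
  have 1: "((\<lambda>s. ln (y + s * e)) has_real_derivative e / y) (at 0)"
    using DERIV_chain2[OF DERIV_ln_divide u] assms by simp
  have 2: "((\<lambda>s. (y + s * e - d)\<^sup>2) has_real_derivative 2 * (y - d) * e) (at 0)"
    by (rule DERIV_cong[OF DERIV_power[OF DERIV_diff[OF u DERIV_const[of d]], of 2]]) simp
  show ?thesis
    using DERIV_add[OF DERIV_minus[OF 1] DERIV_cmult[OF 2, of "\<beta> / 2"]] by (simp add: algebra_simps)
qed

text \<open>The feasible set is convex, so the segment from the minimiser \<open>l\<close> to
  \<open>x\<close> stays inside it, and the objective along it cannot start with negative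
  slope.\<close>

lemma l_update_variational:
  fixes U :: "('p::{finite,linorder}, 'q::{finite,linorder}) rmat"
  assumes l: "is_l_update \<beta> c1 c2 A U l" and c1: "0 < c1" and x: "x \<in> chain_set c1 c2"
  shows "0 \<le> (\<Sum>a\<in>UNIV. (- 1 / l $ a + \<beta> * (l $ a - conj_diag A U $ a)) * (x $ a - l $ a))"
proof (rule ccontr)
  let ?d = "conj_diag A U"
  define h where "h y = - (\<Sum>i\<in>UNIV. ln (y $ i)) + \<beta> / 2 * (norm (y - ?d))\<^sup>2" for y :: "'q rvec"
  define \<phi> where "\<phi> s = h (l + s *\<^sub>R (x - l))" for s
  let ?D = "\<Sum>a\<in>UNIV. (- 1 / l $ a + \<beta> * (l $ a - ?d $ a)) * (x $ a - l $ a)"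
  assume "\<not> 0 \<le> ?D"
  then have neg: "?D < 0" by simp
  have lc: "l \<in> chain_set c1 c2" and min: "\<And>y. y \<in> chain_set c1 c2 \<Longrightarrow> h l \<le> h y"
    using l by (auto simp: is_l_update_def is_arg_min_linorder h_def conj_diag_def)
  have pos: "0 < l $ a" for a using chain_set_bounds(1)[OF lc, of a] c1 by linarith
  have \<phi>: "\<phi> s = (\<Sum>a\<in>UNIV. - ln (l $ a + s * (x $ a - l $ a)) + \<beta> / 2 * (l $ a + s * (x $ a - l $ a) - ?d $ a)\<^sup>2)" for s
    unfolding \<phi>_def h_def power2_norm_eq_inner
    by (simp add: inner_vec_def sum.distrib sum_negf sum_distrib_left power2_eq_square sum_subtractf)
  have "(\<phi> has_real_derivative ?D) (at 0)"
    unfolding \<phi>[abs_def]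
  proof (rule DERIV_sum)
    fix a
    show "((\<lambda>s. - ln (l $ a + s * (x $ a - l $ a)) + \<beta> / 2 * (l $ a + s * (x $ a - l $ a) - ?d $ a)\<^sup>2)
      has_real_derivative (- 1 / l $ a + \<beta> * (l $ a - ?d $ a)) * (x $ a - l $ a)) (at 0)"
      using pos by (rule log_quadratic_deriv)
  qed
  from DERIV_neg_dec_right[OF this neg] obtain \<delta> where \<delta>: "0 < \<delta>" "\<And>s. 0 < s \<Longrightarrow> s < \<delta> \<Longrightarrow> \<phi> s < \<phi> 0"
    unfolding add_0_left by blast
  define s where "s = min 1 (\<delta> / 2)"
  have s: "0 < s" "s < \<delta>" "s \<le> 1" using \<delta>(1) by (auto simp: s_def)
  have "h l \<le> \<phi> s"
    unfolding \<phi>_def by (rule min, rule chain_set_segment[OF lc x]) (use s in auto)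
  then show False using \<delta>(2)[OF s(1,2)] by (simp add: \<phi>_def)
qed

lemma kkt_pointI:
  fixes K :: "('p::{finite,linorder}, 'p) rmat" and w :: "'e::{finite,linorder} rvec"
    and l :: "'q::{finite,linorder} rvec"
  assumes K: "transpose K = K" and \<beta>: "0 < \<beta>" and c1: "0 < c1" and feas: "feasible c1 c2 w l U"
    and w: "w_update K \<beta> w l U = w"
    and U: "Lap w ** U = U ** Diag (conj_diag (Lap w) U)"
    and l: "is_l_update \<beta> c1 c2 (Lap w) U l"
  shows "(w, l, U) \<in> kkt_points K \<beta> c1 c2"
proof -
  let ?d = "conj_diag (Lap w) U"
  define g where "g = grad_w K \<beta> w l U"
  have w0: "\<And>e. 0 \<le> w $ e" and lc: "l \<in> chain_set c1 c2" and UU: "transpose U ** U = mat 1"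
    using feas by (auto simp: feasible_def)
  have lpos: "0 < l $ a" for a using chain_set_bounds(1)[OF lc, of a] c1 by linarith
  have fix_e: "max (w $ e - g $ e / (2 * real CARD('p))) 0 = w $ e" for e
    using arg_cong[OF w, of "\<lambda>v. v $ e"] by (simp add: w_update_def g_def)
  \<comment> \<open>A coordinate fixed by the projected step is either positive with zero gradient
    or zero with nonnegative gradient.\<close>
  have g0: "0 \<le> g $ e" and gw: "g $ e * w $ e = 0" for e
  proof -
    have "0 < 2 * real CARD('p)" by simp
    then show "0 \<le> g $ e" using fix_e[of e] w0[of e] by (auto simp: max_def field_simps split: if_splits)
    show "g $ e * w $ e = 0" using fix_e[of e] by (auto simp: max_def split: if_splits)
  qed
  define \<mu> where "\<mu> = \<beta> *\<^sub>R g"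
  have \<mu>: "\<forall>e. 0 \<le> \<mu> $ e" "\<mu> \<bullet> w = 0"
    using g0 \<beta> by (simp_all add: \<mu>_def inner_vec_def mult.assoc gw)
  from chain_multipliers[OF lc l_update_variational[OF l c1]]
  obtain \<nu> where \<nu>: "\<forall>i \<le> CARD('q). 0 \<le> \<nu> i" "\<nu> 0 * (c1 - l $ ix 1) = 0"
     "\<forall>i. 1 \<le> i \<and> i < CARD('q) \<longrightarrow> \<nu> i * (l $ ix i - l $ ix (i + 1)) = 0"
     "\<nu> CARD('q) * (l $ ix CARD('q) - c2) = 0"
     "\<And>a. \<nu> (pos a) - \<nu> (pos a - 1) = - (- 1 / l $ a + \<beta> * (l $ a - ?d $ a))" by blast
  \<comment> \<open>Since \<open>U\<close> diagonalises \<open>Lap w\<close>, the \<open>U\<close>-gradient of the objective is \<open>U\<close> times a diagonal matrix.\<close>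
  define M where "M = Diag (\<chi> i. \<beta> * ((?d $ i - l $ i) * l $ i))"
  have Z: "(Lap w - U ** Diag l ** transpose U) ** U = U ** Diag ?d - U ** Diag l"
    unfolding bounded_bilinear.diff_left[OF bounded_bilinear_matrix_matrix_mult] U
    by (simp add: matrix_mul_assoc[symmetric] UU)
  have "2 *\<^sub>R (U ** M) - (2 * \<beta>) *\<^sub>R ((Lap w - U ** Diag l ** transpose U) ** U ** Diag l) = 0"
    unfolding Z by (simp add: vec_eq_iff matrix_mult_Diag M_def algebra_simps)
  then have dU: "GDERIV (\<lambda>U'. lagrangian K \<beta> c1 c2 \<mu> \<nu> M w l U') U :> 0"
    using gderiv_lagrangian_U[of M K \<beta> c1 c2 \<mu> \<nu> w l U] by (simp add: M_def transpose_Diag)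
  have dl: "GDERIV (\<lambda>l'. lagrangian K \<beta> c1 c2 \<mu> \<nu> M w l' U) l :> 0"
    by (rule GDERIV_subst[OF gderiv_lagrangian_l[OF UU lpos]]) (simp add: vec_eq_iff \<nu>(5) del: One_nat_def)
  have dw: "GDERIV (\<lambda>w'. lagrangian K \<beta> c1 c2 \<mu> \<nu> M w' l U) w :> 0"
    by (rule GDERIV_subst[OF gderiv_lagrangian_w[OF K]]) (use \<beta> in \<open>auto simp: \<mu>_def g_def\<close>)
  have "transpose M = M" by (simp add: M_def transpose_Diag)
  then show ?thesis
    unfolding kkt_points_def mem_Collect_eq prod.case
    using feas \<mu> \<nu>(1-4) dU dl dw by blast
qed

text \<open>The objective is quadratic in \<open>w\<close>, so its expansion along the step
  \<open>D\<close> is exact. The projection makes the linear term at most -2\<beta>p times the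
  squared length of \<open>D\<close>, the quadratic term costs at most \<beta>p times it, and
  \<beta>p remains.\<close>

lemma w_update_descent:
  fixes K :: "('p::{finite,linorder}, 'p) rmat" and w :: "'e::{finite,linorder} rvec"
  assumes e: "CARD('e) = CARD('p) * (CARD('p) - 1) div 2"
    and K: "transpose K = K" and \<beta>: "0 < \<beta>" and w: "\<forall>e. 0 \<le> w $ e"
  shows "objective K \<beta> (w_update K \<beta> w l U) l U + \<beta> * real CARD('p) * (norm (w_update K \<beta> w l U - w))\<^sup>2
      \<le> objective K \<beta> w l U"
proof -
  let ?p = "real CARD('p)"
  define g where "g = grad_w K \<beta> w l U"
  define D where "D = w_update K \<beta> w l U - w"
  define X where "X = Lap w - U ** Diag l ** transpose U"
  have w': "w_update K \<beta> w l U = w + D" by (simp add: D_def)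
  have De: "D $ i = max (w $ i - g $ i / (2 * ?p)) 0 - w $ i" for i
    by (simp add: D_def w_update_def g_def)
  \<comment> \<open>Without truncation this is an equality; a truncated coordinate has
    \<open>D $ i = - w $ i\<close> and a gradient of at least \<open>2 * ?p * w $ i\<close>.\<close>
  have "D $ i * g $ i \<le> - 2 * ?p * (D $ i * D $ i)" for i
  proof (cases "0 \<le> w $ i - g $ i / (2 * ?p)")
    case True
    then have "g $ i = - 2 * ?p * D $ i" by (simp add: De)
    then show ?thesis by simp
  next
    case False
    then have D: "D $ i = - w $ i" by (simp add: De)
    have "2 * ?p * w $ i \<le> g $ i" using False by (simp add: field_simps)
    then have "w $ i * (2 * ?p * w $ i) \<le> w $ i * g $ i" using w by (intro mult_left_mono) auto
    then show ?thesis by (simp add: D algebra_simps)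
  qed
  then have "D \<bullet> g \<le> (\<Sum>i\<in>UNIV. - 2 * ?p * (D $ i * D $ i))"
    unfolding inner_vec_def by (intro sum_mono) simp
  also have "\<dots> = - 2 * ?p * (norm D)\<^sup>2"
    unfolding power2_norm_eq_inner inner_vec_def by (simp only: sum_distrib_left inner_real_def)
  finally have Dg: "D \<bullet> g \<le> - 2 * ?p * (norm D)\<^sup>2" .
  have LD: "(Lap D :: ('p, 'p) rmat) \<bullet> Lap D \<le> 2 * ?p * (norm D)\<^sup>2"
    using norm_Lap_le[OF e, of D] by (simp add: power2_norm_eq_inner)
  have sum: "(X + L) \<bullet> (X + L) = X \<bullet> X + 2 * (L \<bullet> X) + L \<bullet> L" for L
    by (simp add: inner_add_left inner_add_right inner_commute)
  have XD: "Lap (w + D) - U ** Diag l ** transpose U = X + Lap D"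
    by (simp add: X_def linear_add[OF linear_Lap])
  have KD: "K \<bullet> Lap (w + D) = K \<bullet> Lap w + K \<bullet> Lap D"
    by (simp add: linear_add[OF linear_Lap] inner_add_right)
  have "objective K \<beta> (w + D) l U - objective K \<beta> w l U
      = K \<bullet> Lap D + \<beta> * (Lap D \<bullet> X) + \<beta> / 2 * ((Lap D :: ('p, 'p) rmat) \<bullet> Lap D)"
    unfolding objective_eq[OF K] XD X_def[symmetric] sum KD by (simp add: distrib_left)
  also have "K \<bullet> Lap D + \<beta> * (Lap D \<bullet> X) = \<beta> * (D \<bullet> g)"
    using \<beta> unfolding g_def inner_grad_w X_def[symmetric] inner_commute[of K "Lap D"] by (simp add: distrib_left)
  also have "\<beta> * (D \<bullet> g) + \<beta> / 2 * ((Lap D :: ('p, 'p) rmat) \<bullet> Lap D)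
      \<le> \<beta> * (- 2 * ?p * (norm D)\<^sup>2) + \<beta> / 2 * (2 * ?p * (norm D)\<^sup>2)"
    using Dg LD \<beta> by (intro add_mono mult_left_mono) auto
  finally show ?thesis unfolding w' by (simp add: algebra_simps)
qed

lemma U_update_descent:
  fixes K :: "('p::{finite,linorder}, 'p) rmat" and l :: "'q::{finite,linorder} rvec"
  assumes card: "k + CARD('q) = CARD('p)" and \<beta>: "0 < \<beta>" and c1: "0 < c1"
    and l: "l \<in> chain_set c1 c2" and V: "transpose V ** V = mat 1" and U: "is_U_update k (Lap w) U"
  shows "objective K \<beta> w l U \<le> objective K \<beta> w l V"
proof -
  have UU: "transpose U ** U = mat 1" using U by (simp add: is_U_update_def)
  have "0 \<le> l $ i" for i using chain_set_bounds(1)[OF l, of i] c1 by linarith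
  then have "conj_diag (Lap w) V \<bullet> l \<le> conj_diag (Lap w) U \<bullet> l"
    using U_update_maximizes[OF transpose_Lap card U V, of l] l
    by (simp add: inner_vec_def conj_diag_def chain_set_iff mult.commute)
  then show ?thesis
    unfolding objective_def norm_residual[OF UU] norm_residual[OF V] using \<beta> by simp
qed

lemma l_update_descent:
  assumes UU: "transpose U ** U = mat 1" and l: "is_l_update \<beta> c1 c2 (Lap w) U l" and x: "x \<in> chain_set c1 c2"
  shows "objective K \<beta> w l U \<le> objective K \<beta> w x U"
proof -
  have sq: "(norm (y - d))\<^sup>2 = y \<bullet> y - 2 * (d \<bullet> y) + d \<bullet> d" for y d :: "real^'n"
    unfolding power2_norm_eq_inner by (simp add: inner_diff_left inner_diff_right inner_commute)
  show ?thesis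
    using l x unfolding objective_def norm_residual[OF UU] is_l_update_def is_arg_min_linorder conj_diag_def[symmetric] sq
    by (auto simp: algebra_simps)
qed

text \<open>This removes \<open>eigval\<close> from the eigenvector equation. Both sides are now
  continuous in \<open>A\<close> and \<open>U\<close>, so the equation passes to limits with no
  appeal to continuity of polynomial roots.\<close>

lemma U_update_eigenvectors:
  assumes U: "is_U_update k A U"
  shows "A ** U = U ** Diag (conj_diag A U)"
proof -
  have "transpose U ** U = mat 1" using U by (simp add: is_U_update_def)
  then have unit: "column j U \<bullet> column j U = 1" for j
    using transpose_mult_eq_inner[of U j j] by (simp add: mat_def)
  have eig: "A *v column j U = eigval A (k + pos j) *\<^sub>R column j U" for j
    using U pos_ge_1[of j] pos_le_card[of j] unfolding is_U_update_def by (metis ix_pos)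
  have "(A ** U) $ i $ j = (U ** Diag (conj_diag A U)) $ i $ j" for i j
  proof -
    have "conj_diag A U $ j = eigval A (k + pos j)"
      by (simp add: conj_diag_def conj_diag_eq eig unit)
    moreover have "(A ** U) $ i $ j = (A *v column j U) $ i"
      by (simp add: matrix_matrix_mult_def matrix_vector_mult_def column_def)
    ultimately show ?thesis unfolding eig by (simp add: matrix_mult_Diag column_def)
  qed
  then show ?thesis by (simp add: vec_eq_iff)
qed

text \<open>Otherwise a subsequence keeps a positive distance from \<open>X\<close>; by compactness
  part of it converges, and its limit would be a point of \<open>X\<close> at positive distance from
  \<open>X\<close>.\<close>

lemma infdist_tendsto_zero_if_limit_points:
  fixes z :: "nat \<Rightarrow> 'a::heine_borel"
  assumes bdd: "bounded (range z)"
    and lim: "\<And>r x. strict_mono r \<Longrightarrow> (\<lambda>n. z (r n)) \<longlonglongrightarrow> x \<Longrightarrow> x \<in> X"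
  shows "X \<noteq> {} \<and> (\<lambda>n. infdist (z n) X) \<longlonglongrightarrow> 0"
proof
  show "X \<noteq> {}"
    using bounded_imp_convergent_subsequence[OF bdd] lim by (auto simp: o_def)
  show "(\<lambda>n. infdist (z n) X) \<longlonglongrightarrow> 0"
  proof (rule ccontr)
    assume "\<not> (\<lambda>n. infdist (z n) X) \<longlonglongrightarrow> 0"
    then obtain e where e: "0 < e" "\<forall>N. \<exists>n\<ge>N. e \<le> infdist (z n) X"
      by (auto simp: LIMSEQ_iff infdist_nonneg not_less)
    then have "infinite {n. e \<le> infdist (z n) X}" unfolding infinite_nat_iff_unbounded_le by auto
    from infinite_enumerate[OF this] obtain r :: "nat \<Rightarrow> nat"
      where r: "strict_mono r" "\<And>n. e \<le> infdist (z (r n)) X" by auto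
    have "bounded (range (z \<circ> r))" using bdd by (rule bounded_subset) auto
    from bounded_imp_convergent_subsequence[OF this] obtain x r'
      where r': "strict_mono r'" "(\<lambda>n. z (r (r' n))) \<longlonglongrightarrow> x" by (auto simp: o_def)
    have "x \<in> X" using lim[of "r \<circ> r'" x] strict_mono_o[OF r(1) r'(1)] r'(2) by simp
    moreover have "(\<lambda>n. infdist (z (r (r' n))) X) \<longlonglongrightarrow> infdist x X"
      by (rule tendsto_infdist[OF r'(2)])
    then have "e \<le> infdist x X" by (rule LIMSEQ_le_const) (use r(2) in auto)
    ultimately show False using e(1) by simp
  qed
qed

section \<open>Stability of the update conditions under limits\<close>

lemma tendsto_matrix_mult:
  "(f \<longlongrightarrow> A) F \<Longrightarrow> (g \<longlongrightarrow> B) F \<Longrightarrow> ((\<lambda>x. f x ** g x) \<longlongrightarrow> A ** B) F"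
  for A :: "real^'k^'m" and B :: "real^'n^'k"
  by (rule bounded_bilinear.tendsto[OF bounded_bilinear_matrix_matrix_mult])

lemmas tendsto_matrix_simps =
  tendsto_matrix_mult bounded_linear_matrix_simps[THEN bounded_linear.tendsto]

lemma tendsto_conj_diag:
  "(f \<longlongrightarrow> A) F \<Longrightarrow> (g \<longlongrightarrow> U) F \<Longrightarrow> ((\<lambda>x. conj_diag (f x) (g x)) \<longlongrightarrow> conj_diag A U) F"
  unfolding conj_diag_def by (intro tendsto_vec_lambda tendsto_vec_nth tendsto_matrix_simps)

lemma tendsto_w_update:
  fixes K :: "('p::{finite,linorder}, 'p) rmat" and w :: "'e::{finite,linorder} rvec"
  assumes "(fw \<longlongrightarrow> w) F" "(fl \<longlongrightarrow> l) F" "(fU \<longlongrightarrow> U) F"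
  shows "((\<lambda>x. w_update K \<beta> (fw x) (fl x) (fU x)) \<longlongrightarrow> w_update K \<beta> w l U) F"
  unfolding w_update_def grad_w_def
  by (intro tendsto_vec_lambda tendsto_max tendsto_vec_nth tendsto_diff tendsto_scaleR tendsto_const
      tendsto_matrix_simps assms)

lemma LIMSEQ_chain_set:
  fixes l :: "'q::{finite,linorder} rvec"
  assumes "f \<longlonglongrightarrow> l" "\<And>n. f n \<in> chain_set c1 c2"
  shows "l \<in> chain_set c1 c2"
proof -
  have nth: "(\<lambda>n. f n $ i) \<longlonglongrightarrow> l $ i" for i by (rule tendsto_vec_nth[OF assms(1)])
  show ?thesis
    using assms(2) unfolding chain_set_def mem_Collect_eq
    by (auto intro: LIMSEQ_le[OF nth nth] LIMSEQ_le_const[OF nth] LIMSEQ_le_const2[OF nth])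
qed

text \<open>Each minimiser is compared with one fixed competitor \<open>x\<close> of the same
  constraint set, and both values converge; the bound \<open>c1\<close> keeps all entries where
  \<open>ln\<close> is continuous.\<close>

lemma is_l_update_limit:
  fixes fl :: "nat \<Rightarrow> 'q::{finite,linorder} rvec"
  assumes A: "fA \<longlonglongrightarrow> A" and U: "fU \<longlonglongrightarrow> U" and l: "fl \<longlonglongrightarrow> l" and c1: "0 < c1"
    and upd: "\<And>n. is_l_update \<beta> c1 c2 (fA n) (fU n) (fl n)"
  shows "is_l_update \<beta> c1 c2 A U l"
proof -
  have ch: "fl n \<in> chain_set c1 c2" for n using upd[of n] by (simp add: is_l_update_def is_arg_min_def)
  have lc: "l \<in> chain_set c1 c2" by (rule LIMSEQ_chain_set[OF l ch])
  have nz: "y $ i \<noteq> 0" if "y \<in> chain_set c1 c2" for y :: "'q rvec" and i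
    using chain_set_bounds(1)[OF that, of i] c1 by auto
  let ?h = "\<lambda>x d. - (\<Sum>i\<in>UNIV. ln (x $ i)) + \<beta> / 2 * (norm (x - d))\<^sup>2"
  have h: "(\<lambda>n. ?h (g n) (conj_diag (fA n) (fU n))) \<longlonglongrightarrow> ?h x (conj_diag A U)"
    if "g \<longlonglongrightarrow> x" "x \<in> chain_set c1 c2" for g and x :: "'q rvec"
    by (intro tendsto_intros that tendsto_conj_diag A U nz)
  have "?h l (conj_diag A U) \<le> ?h x (conj_diag A U)" if x: "x \<in> chain_set c1 c2" for x
  proof (rule LIMSEQ_le[OF h[OF l lc] h[OF tendsto_const x]])
    show "\<exists>N. \<forall>n\<ge>N. ?h (fl n) (conj_diag (fA n) (fU n)) \<le> ?h x (conj_diag (fA n) (fU n))"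
      using upd x by (auto simp: is_l_update_def is_arg_min_linorder conj_diag_def)
  qed
  then show ?thesis using lc by (simp add: is_l_update_def is_arg_min_linorder conj_diag_def)
qed

lemma objective_lower_bound:
  fixes S :: "('p::{finite,linorder}, 'p) rmat" and w :: "'e::{finite,linorder} rvec"
    and l :: "'q::{finite,linorder} rvec"
  assumes e: "CARD('e) = CARD('p) * (CARD('p) - 1) div 2"
    and S: "transpose S = S" "\<forall>x. 0 \<le> x \<bullet> (S *v x)"
    and K: "K = S + \<alpha> *\<^sub>R (2 *\<^sub>R mat 1 - ones_mat)"
    and "0 < \<beta>" "0 < c1" and feas: "feasible c1 c2 w l U"
  shows "4 * \<alpha> * (\<Sum>e\<in>UNIV. w $ e) - real CARD('q) * ln c2 \<le> objective K \<beta> w l U"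
proof -
  have w: "\<forall>e. 0 \<le> w $ e" and l: "l \<in> chain_set c1 c2" using feas by (auto simp: feasible_def)
  have "(\<Sum>i\<in>UNIV. ln (l $ i)) \<le> (\<Sum>i\<in>(UNIV :: 'q set). ln c2)"
  proof (rule sum_mono)
    fix i
    show "ln (l $ i) \<le> ln c2"
      using chain_set_bounds[OF l, of i] \<open>0 < c1\<close> by simp
  qed
  moreover have "0 \<le> \<beta> / 2 * (norm (Lap w - U ** Diag l ** transpose U))\<^sup>2" using \<open>0 < \<beta>\<close> by simp
  ultimately show ?thesis
    using trace_K_Lap_ge[OF e S w K] unfolding objective_def by simp
qed

lemma norm_orthonormal_columns:
  fixes U :: "real^'q^'p"
  assumes "transpose U ** U = mat 1"
  shows "norm U = norm (mat 1 :: real^'q^'q)"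
proof -
  have "U \<bullet> (U ** mat 1) = (mat 1 :: real^'q^'q) \<bullet> mat 1"
    unfolding inner_matrix_mult_left assms ..
  then show ?thesis by (simp add: norm_eq)
qed

text \<open>A decreasing sequence bounded below converges, so its successive drops, which dominate
  \<open>g\<close>, vanish.\<close>

lemma diff_tendsto_zero_if_descent:
  fixes f g :: "nat \<Rightarrow> real"
  assumes "\<And>t. f (Suc t) + g t \<le> f t" "\<And>t. 0 \<le> g t" "\<And>t. B \<le> f t"
  shows "g \<longlonglongrightarrow> 0"
proof -
  have "f (Suc t) \<le> f t" for t using assms(1)[of t] assms(2)[of t] by linarith
  then have "decseq f" by (rule decseq_SucI)
  with assms(3) obtain L where L: "f \<longlonglongrightarrow> L" using decseq_convergent by blast
  have "(\<lambda>t. f t - f (Suc t)) \<longlonglongrightarrow> L - L" by (intro tendsto_diff L LIMSEQ_Suc)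
  then have lim: "(\<lambda>t. f t - f (Suc t)) \<longlonglongrightarrow> 0" by simp
  have "g t \<le> f t - f (Suc t)" for t using assms(1)[of t] by linarith
  then show ?thesis
    using assms(2) by (intro tendsto_sandwich[OF _ _ tendsto_const lim]) (auto intro: always_eventually)
qed

section \<open>Properties of the generated sequence\<close>

lemma sgl_feasible:
  assumes 0: "feasible c1 c2 (w 0) (l 0) (U 0)" and sgl: "sgl_sequence k K \<beta> c1 c2 w l U"
  shows "feasible c1 c2 (w t) (l t) (U t)"
proof (cases t)
  case (Suc s)
  have "w (Suc s) = w_update K \<beta> (w s) (l s) (U s)" "is_U_update k (Lap (w (Suc s))) (U (Suc s))"
    "is_l_update \<beta> c1 c2 (Lap (w (Suc s))) (U (Suc s)) (l (Suc s))"
    using sgl unfolding sgl_sequence_def by blast+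
  then show ?thesis
    unfolding Suc feasible_def is_U_update_def is_l_update_def is_arg_min_def
    by (auto simp: w_update_def)
qed (use 0 in simp)

lemma sgl_descent:
  fixes K :: "('p::{finite,linorder}, 'p) rmat" and w :: "nat \<Rightarrow> 'e::{finite,linorder} rvec"
    and l :: "nat \<Rightarrow> 'q::{finite,linorder} rvec"
  assumes card: "k + CARD('q) = CARD('p)" and e: "CARD('e) = CARD('p) * (CARD('p) - 1) div 2"
    and K: "transpose K = K" and pos: "0 < \<beta>" "0 < c1"
    and feas: "feasible c1 c2 (w t) (l t) (U t)" and sgl: "sgl_sequence k K \<beta> c1 c2 w l U"
  shows "objective K \<beta> (w (Suc t)) (l (Suc t)) (U (Suc t)) + \<beta> * real CARD('p) * (norm (w (Suc t) - w t))\<^sup>2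
    \<le> objective K \<beta> (w t) (l t) (U t)"
proof -
  have upd: "w (Suc t) = w_update K \<beta> (w t) (l t) (U t)" "is_U_update k (Lap (w (Suc t))) (U (Suc t))"
    "is_l_update \<beta> c1 c2 (Lap (w (Suc t))) (U (Suc t)) (l (Suc t))"
    using sgl unfolding sgl_sequence_def by blast+
  have f: "\<forall>e. 0 \<le> w t $ e" "l t \<in> chain_set c1 c2" "transpose (U t) ** U t = mat 1"
    using feas by (auto simp: feasible_def)
  have "transpose (U (Suc t)) ** U (Suc t) = mat 1" using upd(2) by (simp add: is_U_update_def)
  note l_update_descent[OF this upd(3) f(2), of K]
  also note U_update_descent[OF card pos f(2,3) upd(2), of K]
  finally show ?thesis
    using w_update_descent[OF e K pos(1) f(1), of "l t" "U t"] unfolding upd(1) by linarith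
qed

lemma sgl_limit_point_kkt:
  fixes K :: "('p::{finite,linorder}, 'p) rmat" and w :: "nat \<Rightarrow> 'e::{finite,linorder} rvec"
    and l :: "nat \<Rightarrow> 'q::{finite,linorder} rvec"
  assumes K: "transpose K = K" and pos: "0 < \<beta>" "0 < c1"
    and feas: "feasible c1 c2 (w 0) (l 0) (U 0)" and sgl: "sgl_sequence k K \<beta> c1 c2 w l U"
    and diff: "(\<lambda>t. w (Suc t) - w t) \<longlonglongrightarrow> 0" and r: "strict_mono r"
    and lim: "(\<lambda>n. (w (Suc (r n)), l (Suc (r n)), U (Suc (r n)))) \<longlonglongrightarrow> x"
  shows "x \<in> kkt_points K \<beta> c1 c2"
proof -
  obtain w' l' U' where x: "x = (w', l', U')" by (cases x)
  let ?w = "\<lambda>n. w (Suc (r n))" and ?l = "\<lambda>n. l (Suc (r n))" and ?U = "\<lambda>n. U (Suc (r n))"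
  have w': "?w \<longlonglongrightarrow> w'" and l': "?l \<longlonglongrightarrow> l'" and U': "?U \<longlonglongrightarrow> U'"
    using tendsto_fst[OF lim] tendsto_fst[OF tendsto_snd[OF lim]] tendsto_snd[OF tendsto_snd[OF lim]]
    by (simp_all add: x)
  have upd: "w (Suc t) = w_update K \<beta> (w t) (l t) (U t)" "is_U_update k (Lap (w (Suc t))) (U (Suc t))"
    "is_l_update \<beta> c1 c2 (Lap (w (Suc t))) (U (Suc t)) (l (Suc t))" for t
    using sgl unfolding sgl_sequence_def by blast+
  have f: "\<And>e. 0 \<le> w t $ e" "l t \<in> chain_set c1 c2" "transpose (U t) ** U t = mat 1" for t
    using sgl_feasible[OF feas sgl, of t] by (auto simp: feasible_def)
  have "0 \<le> w' $ e" for e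
    by (rule LIMSEQ_le_const[OF tendsto_vec_nth[OF w']]) (use f(1) in auto)
  moreover have "l' \<in> chain_set c1 c2" by (rule LIMSEQ_chain_set[OF l' f(2)])
  moreover have "(\<lambda>n. transpose (?U n) ** ?U n) \<longlonglongrightarrow> transpose U' ** U'"
    by (intro tendsto_matrix_simps U')
  then have "transpose U' ** U' = mat 1" by (simp add: f(3) LIMSEQ_const_iff)
  ultimately have feas': "feasible c1 c2 w' l' U'" by (simp add: feasible_def)
  have "strict_mono (\<lambda>n. Suc (r n))" using r by (simp add: strict_mono_def)
  \<comment> \<open>The weights one step later have the same limit \<open>w'\<close>, and they are
    the \<open>w_update\<close> of the current triple; continuity makes \<open>w'\<close> a fixed
    point.\<close>
  from LIMSEQ_subseq_LIMSEQ[OF diff this] w'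
  have "(\<lambda>n. (w (Suc (Suc (r n))) - ?w n) + ?w n) \<longlonglongrightarrow> 0 + w'"
    by (intro tendsto_add) (auto simp: o_def)
  then have "(\<lambda>n. w_update K \<beta> (?w n) (?l n) (?U n)) \<longlonglongrightarrow> w'"
    unfolding upd(1)[of "Suc _"] by simp
  then have "w_update K \<beta> w' l' U' = w'"
    by (rule LIMSEQ_unique[OF tendsto_w_update[OF w' l' U']])
  moreover have LU: "(\<lambda>n. Lap (?w n)) \<longlonglongrightarrow> (Lap w' :: ('p, 'p) rmat)" by (intro tendsto_matrix_simps w')
  have "(\<lambda>n. ?U n ** Diag (conj_diag (Lap (?w n)) (?U n))) \<longlonglongrightarrow> U' ** Diag (conj_diag (Lap w') U')"
    by (intro tendsto_matrix_simps tendsto_conj_diag LU U')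
  then have "(\<lambda>n. Lap (?w n) ** ?U n) \<longlonglongrightarrow> U' ** Diag (conj_diag (Lap w') U')"
    unfolding U_update_eigenvectors[OF upd(2)] .
  then have "Lap w' ** U' = U' ** Diag (conj_diag (Lap w') U')"
    by (rule LIMSEQ_unique[OF tendsto_matrix_mult[OF LU U']])
  moreover have "is_l_update \<beta> c1 c2 (Lap w') U' l'"
    by (rule is_l_update_limit[OF LU U' l' pos(2) upd(3)])
  ultimately show ?thesis unfolding x by (intro kkt_pointI[OF K pos feas'])
qed

(* The distance to the empty set is +infinity by convention, whereas infdist x {} = 0;
   hence the non-emptiness conjunct. *)
theorem theorem1:
  fixes k :: nat and c1 c2 \<alpha> \<beta> :: real
    and S K :: "('p::{finite,linorder}, 'p) rmat"
    and w :: "nat \<Rightarrow> 'e::{finite,linorder} rvec"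
    and l :: "nat \<Rightarrow> 'q::{finite,linorder} rvec"
    and U :: "nat \<Rightarrow> ('p, 'q) rmat"
  assumes "2 \<le> CARD('p)" and "1 \<le> k" and "k < CARD('p)"
    and "CARD('q) = CARD('p) - k"
    and "CARD('e) = CARD('p) * (CARD('p) - 1) div 2"
    and "0 < c1" and "c1 \<le> c2" and "0 < \<alpha>" and "0 < \<beta>"
    and "transpose S = S" and "\<forall>x. 0 \<le> x \<bullet> (S *v x)"
    and "K = S + \<alpha> *\<^sub>R (2 *\<^sub>R mat 1 - ones_mat)"
    and "feasible c1 c2 (w 0) (l 0) (U 0)"
    and "sgl_sequence k K \<beta> c1 c2 w l U"
  shows "(kkt_points K \<beta> c1 c2
            :: ('e rvec \<times> 'q rvec \<times> ('p, 'q) rmat) set) \<noteq> {} \<and>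
         (\<lambda>t. infdist (w t, l t, U t) (kkt_points K \<beta> c1 c2)) \<longlonglongrightarrow> 0"
proof -
  note sgl = assms(14) and feas0 = assms(13)
  have card: "k + CARD('q) = CARD('p)" using assms(3,4) by simp
  have K: "transpose K = K"
    using assms(10) by (auto simp: assms(12) transpose_def vec_eq_iff mat_def ones_mat_def)
  have feas: "feasible c1 c2 (w t) (l t) (U t)" for t by (rule sgl_feasible[OF feas0 sgl])
  then have wpos: "0 \<le> w t $ e" for t e by (simp add: feasible_def)
  define obj where "obj t = objective K \<beta> (w t) (l t) (U t)" for t
  let ?B = "real CARD('q) * ln c2"
  have lower: "4 * \<alpha> * (\<Sum>e\<in>UNIV. w t $ e) - ?B \<le> obj t" for t
    unfolding obj_def by (rule objective_lower_bound[OF assms(5,10,11,12,9,6) feas])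
  have desc: "obj (Suc t) + \<beta> * real CARD('p) * (norm (w (Suc t) - w t))\<^sup>2 \<le> obj t" for t
    unfolding obj_def by (rule sgl_descent[OF card assms(5) K assms(9,6) feas sgl])
  have obj_ge: "- ?B \<le> obj t" for t
  proof -
    have "0 \<le> 4 * \<alpha> * (\<Sum>e\<in>UNIV. w t $ e)"
      using assms(8) by (intro mult_nonneg_nonneg sum_nonneg wpos) auto
    then show ?thesis using lower[of t] by linarith
  qed
  have "(\<lambda>t. \<beta> * real CARD('p) * (norm (w (Suc t) - w t))\<^sup>2) \<longlonglongrightarrow> 0"
    by (rule diff_tendsto_zero_if_descent[where f = obj, OF desc _ obj_ge]) (use assms(9) in simp)
  from tendsto_mult_left[OF this, of "1 / (\<beta> * real CARD('p))"] assms(9)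
  have "(\<lambda>t. (norm (w (Suc t) - w t))\<^sup>2) \<longlonglongrightarrow> 0" by simp
  from tendsto_real_sqrt[OF this] have diff: "(\<lambda>t. w (Suc t) - w t) \<longlonglongrightarrow> 0"
    by (simp add: tendsto_norm_zero_iff)
  have "decseq obj"
  proof (rule decseq_SucI)
    fix t
    have "0 \<le> \<beta> * real CARD('p) * (norm (w (Suc t) - w t))\<^sup>2" using assms(9) by simp
    then show "obj (Suc t) \<le> obj t" using desc[of t] by linarith
  qed
  \<comment> \<open>For nonnegative weights the sum is the l1 norm, so the lower bound on the
    decreasing objective bounds the norm.\<close>
  have "norm (w t) \<le> (obj 0 + ?B) / (4 * \<alpha>)" for t
  proof -
    have "norm (w t) \<le> (\<Sum>e\<in>UNIV. \<bar>w t $ e\<bar>)" by (rule norm_le_l1_cart)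
    also have "\<dots> = (\<Sum>e\<in>UNIV. w t $ e)" by (simp add: wpos)
    also have "\<dots> \<le> (obj 0 + ?B) / (4 * \<alpha>)"
      using lower[of t] decseqD[OF \<open>decseq obj\<close>, of 0 t] assms(8) by (simp add: field_simps)
    finally show ?thesis .
  qed
  moreover have "norm (l t) \<le> real CARD('q) * c2" for t
  proof -
    have l: "l t \<in> chain_set c1 c2" using feas[of t] by (simp add: feasible_def)
    have "norm (l t) \<le> (\<Sum>i\<in>UNIV. \<bar>l t $ i\<bar>)" by (rule norm_le_l1_cart)
    also have "\<dots> \<le> (\<Sum>i\<in>(UNIV :: 'q set). c2)"
    proof (rule sum_mono)
      fix i
      show "\<bar>l t $ i\<bar> \<le> c2"
        using chain_set_bounds[OF l, of i] assms(6) by simp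
    qed
    finally show ?thesis by simp
  qed
  moreover have "norm (U t) \<le> norm (mat 1 :: ('q, 'q) rmat)" for t
    using norm_orthonormal_columns[of "U t"] feas[of t] by (simp add: feasible_def)
  ultimately have "range (\<lambda>t. (w (Suc t), l (Suc t), U (Suc t)))
      \<subseteq> cball 0 ((obj 0 + ?B) / (4 * \<alpha>)) \<times> cball 0 (real CARD('q) * c2) \<times> cball 0 (norm (mat 1 :: ('q, 'q) rmat))"
    by auto
  then have "bounded (range (\<lambda>t. (w (Suc t), l (Suc t), U (Suc t))))"
    by (rule bounded_subset[rotated]) (intro bounded_Times bounded_cball)
  note * = infdist_tendsto_zero_if_limit_points[OF this, of "kkt_points K \<beta> c1 c2"]
  have "kkt_points K \<beta> c1 c2 \<noteq> ({} :: ('e rvec \<times> 'q rvec \<times> ('p, 'q) rmat) set) \<and>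
      (\<lambda>t. infdist (w (Suc t), l (Suc t), U (Suc t)) (kkt_points K \<beta> c1 c2)) \<longlonglongrightarrow> 0"
    by (rule *) (rule sgl_limit_point_kkt[OF K assms(9,6) feas0 sgl diff])
  then show ?thesis
    using LIMSEQ_imp_Suc[of "\<lambda>t. infdist (w t, l t, U t) (kkt_points K \<beta> c1 c2)" 0] by simp
qed

end
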